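(* Let $n\ge1$, $0\le q\le n-1$, and let $L[w]=w^{(n)}+\sum_{j=0}^{n-1}(a_j+b_jz)w^{(j)}$ with complex constants $a_j,b_j$ such that $a_0+b_0z\not\equiv0$, $b_j=0$ for $j>q$, and $b_q=(-1)^{n-q+1}$. Let $Q_0,Q_1,\phi_L$ be as in the context. Suppose that $t=0$ is a pole of $Q_0/Q_1$ of order $p\ge1$ with integer residue $\lambda_0=\operatorname{res}_{0}[Q_0/Q_1]$. Then the solution $$w(z)=\operatorname{res}_{t=0}\big[\phi_L(t)e^{-zt}\big]$$ of $L[w]=0$ has order of growth $\varrho=1-\frac1p$ if $t=0$ is an essential singularity of $\phi_L$, that is, if $p>1$; and otherwise (if $p=1$) $w$ is a non-trivial polynomial of degree $\lambda_0$ when $\lambda_0\ge0$, and vanishes identically when $\lambda_0<0$.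
   Context: $Q_0(t)=(-t)^n+\sum_{j=0}^{n-1}a_j(-t)^j$, $Q_1(t)=\sum_{j=0}^{q}b_j(-t)^j$, and $$\phi_L(t)=\frac1{Q_1(t)}\exp\Big[-\int\frac{Q_0(t)}{Q_1(t)}\,dt\Big],$$ determined up to a non-zero constant factor. Since the residue of $Q_0/Q_1$ at $0$ is an integer, $\phi_L$ has a single-valued holomorphic branch in a punctured neighbourhood of $t=0$; such a branch is used in the residue. The order of growth of an entire function $f$ is $\limsup_{r\to\infty}\frac{\log\log M(r,f)}{\log r}$ with $M(r,f)=\max_{|z|=r}|f(z)|$. *)

theory Defs
  imports "HOL-Complex_Analysis.Complex_Analysis" "HOL-Library.Extended_Real"
begin

definition L_op ::
  "nat \<Rightarrow> (nat \<Rightarrow> complex) \<Rightarrow> (nat \<Rightarrow> complex) \<Rightarrow> (complex \<Rightarrow> complex) \<Rightarrow> complex \<Rightarrow> complex" where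
  "L_op n a b w z = (deriv ^^ n) w z + (\<Sum>j<n. (a j + b j * z) * (deriv ^^ j) w z)"

definition Q0 :: "nat \<Rightarrow> (nat \<Rightarrow> complex) \<Rightarrow> complex \<Rightarrow> complex" where
  "Q0 n a t = (- t) ^ n + (\<Sum>j<n. a j * (- t) ^ j)"

definition Q1 :: "nat \<Rightarrow> (nat \<Rightarrow> complex) \<Rightarrow> complex \<Rightarrow> complex" where
  "Q1 q b t = (\<Sum>j\<le>q. b j * (- t) ^ j)"

text \<open>
  A single-valued holomorphic branch on S of exp (- F) / Q1, where F is an antiderivative
  of Q0 / Q1.  The antiderivative is only required to exist locally, since it is in general
  multi-valued around 0.  The arbitrary non-zero constant factor is the exponential of the
  constant of integration; on a connected S it is the only freedom.
\<close>

definition phi_L_branch ::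
  "nat \<Rightarrow> nat \<Rightarrow> (nat \<Rightarrow> complex) \<Rightarrow> (nat \<Rightarrow> complex) \<Rightarrow> complex set \<Rightarrow> (complex \<Rightarrow> complex) \<Rightarrow> bool" where
  "phi_L_branch n q a b S \<phi> \<longleftrightarrow>
     \<phi> holomorphic_on S \<and>
     (\<forall>s\<in>S. \<exists>U F. open U \<and> s \<in> U \<and> U \<subseteq> S \<and>
        (\<forall>t\<in>U. Q1 q b t \<noteq> 0 \<and>
               (F has_field_derivative Q0 n a t / Q1 q b t) (at t) \<and>
               \<phi> t = 1 / Q1 q b t * exp (- F t)))"

definition essential_singularity_at :: "(complex \<Rightarrow> complex) \<Rightarrow> complex \<Rightarrow> bool" where
  "essential_singularity_at f z \<longleftrightarrow> isolated_singularity_at f z \<and> \<not> not_essential f z"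

definition max_modulus :: "real \<Rightarrow> (complex \<Rightarrow> complex) \<Rightarrow> real" where
  "max_modulus r f = (SUP z\<in>sphere 0 r. norm (f z))"

definition growth_order :: "(complex \<Rightarrow> complex) \<Rightarrow> ereal" where
  "growth_order f = Limsup at_top (\<lambda>r. ereal (ln (ln (max_modulus r f)) / ln r))"

definition residue_solution :: "(complex \<Rightarrow> complex) \<Rightarrow> complex \<Rightarrow> complex" where
  "residue_solution \<phi> z = residue (\<lambda>t. \<phi> t * exp (- z * t)) 0"

end

theory Submission
  imports Defs "HOL-Real_Asymp.Real_Asymp"
begin

text \<open>
  Near 0 the branch has the normal form \<open>\<phi>(t) = t\<^sup>k E(t) exp (T(t) / t\<^sup>m)\<close> with \<open>m = p - 1\<close>,
  \<open>k = - (p + \<lambda>\<^sub>0)\<close>, holomorphic \<open>E\<close>, \<open>T\<close> and \<open>E(0) \<noteq> 0\<close>, where \<open>T(0) \<noteq> 0\<close> if \<open>m > 0\<close>.  The equation \<open>L[w] = 0\<close> holds because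
  \<open>(Q\<^sub>0 + z Q\<^sub>1) \<phi> e\<^sup>-\<^sup>z\<^sup>t\<close> is the derivative of \<open>- \<phi> Q\<^sub>1 e\<^sup>-\<^sup>z\<^sup>t\<close>.

  For \<open>p = 1\<close> the Taylor coefficients of \<open>w\<close> at 0 are residues of \<open>t\<^sup>j \<phi>(t)\<close> and vanish for \<open>j > \<lambda>\<^sub>0\<close>.
  For \<open>p > 1\<close>, integrating over the circle of radius \<open>R\<close> to the power \<open>- 1 / p\<close> bounds \<open>w\<close> on
  \<open>|z| = R\<close> and gives the order from above.  Conversely, if \<open>log M(R, w) \<le> R\<^sup>\<sigma>\<close> with
  \<open>\<sigma> < 1 - 1 / p\<close>, then Cauchy's inequality for the Taylor coefficients of \<open>w\<close> bounds the
  principal part of the Laurent series of \<open>\<phi>\<close> by \<open>exp (C |t|\<^sup>-\<^sup>\<tau>)\<close> with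
  \<open>\<tau> = \<sigma> / (1 - \<sigma>) < p - 1\<close>.  This contradicts the growth of \<open>\<phi>\<close> along a ray on which
  \<open>T(0) / t\<^sup>m\<close> is positive.
\<close>

section \<open>Growth order\<close>

text \<open>A real supremum bounds its family only if the family is bounded above; compactness of
  the circle provides this.\<close>

lemma norm_le_max_modulus:
  assumes "continuous_on UNIV f" "norm z = r"
  shows "norm (f z) \<le> max_modulus r f"
proof -
  have "continuous_on (sphere 0 r) (\<lambda>z. norm (f z))"
    using assms(1) by (intro continuous_on_norm) (rule continuous_on_subset, auto)
  then have "compact ((\<lambda>z. norm (f z)) ` sphere 0 r)"
    by (rule compact_continuous_image) simp
  then have "bdd_above ((\<lambda>z. norm (f z)) ` sphere 0 r)"
    by (intro bounded_imp_bdd_above compact_imp_bounded)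
  then show ?thesis
    unfolding max_modulus_def using assms(2) by (intro cSUP_upper) auto
qed

lemma max_modulus_leI:
  assumes "r \<ge> 0" "\<And>z. norm z = r \<Longrightarrow> norm (f z) \<le> B"
  shows "max_modulus r f \<le> B"
  unfolding max_modulus_def using assms
  by (intro cSUP_least) auto

text \<open>The maximum modulus principle on the disc of radius \<open>s\<close>.\<close>

lemma max_modulus_mono:
  assumes f: "f holomorphic_on UNIV" and "0 \<le> r" "r \<le> s"
  shows "max_modulus r f \<le> max_modulus s f"
proof (rule max_modulus_leI)
  have cont: "continuous_on UNIV f"
    using f by (rule holomorphic_on_imp_continuous_on)
  fix z :: complex assume z: "norm z = r"
  show "norm (f z) \<le> max_modulus s f"
  proof (cases "s = 0")
    case True
    then show ?thesis using norm_le_max_modulus[OF cont z] assms by auto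
  next
    case False
    show ?thesis
    proof (rule maximum_modulus_frontier[of f "cball 0 s"])
      show "f holomorphic_on interior (cball 0 s)"
        using f by (rule holomorphic_on_subset) auto
      show "continuous_on (closure (cball 0 s)) f"
        using cont by (rule continuous_on_subset) auto
      show "norm (f w) \<le> max_modulus s f" if "w \<in> frontier (cball 0 s)" for w
        using that norm_le_max_modulus[OF cont, of w s] False assms by simp
    qed (use z assms in auto)
  qed
qed (use assms in auto)

text \<open>Undoing both logarithms turns a comparison of the limsup with \<open>\<sigma>\<close>
  into a comparison of M(r, f) with exp(r^\<sigma>). A limsup below \<open>\<alpha>\<close> would
  make such a bound hold eventually for some smaller \<open>\<sigma>\<close>, so it suffices to
  refute these.\<close>

lemma growth_order_eqI:
  assumes f: "f holomorphic_on UNIV" and "\<alpha> > 0"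
    and upper: "\<And>\<sigma>. \<sigma> > \<alpha> \<Longrightarrow> \<forall>\<^sub>F r in at_top. max_modulus r f \<le> exp (r powr \<sigma>)"
    and lower: "\<And>\<sigma>. 0 < \<sigma> \<Longrightarrow> \<sigma> < \<alpha> \<Longrightarrow> \<not> (\<forall>\<^sub>F r in at_top. max_modulus r f \<le> exp (r powr \<sigma>))"
  shows "growth_order f = ereal \<alpha>"
proof (rule antisym)
  \<comment> \<open>The failing bound at exponent \<open>\<alpha> / 2\<close> gives one radius with
    modulus above 1. Monotonicity extends this to all larger radii, so both logarithms have positive
    arguments there.\<close>
  obtain r0 where r0: "r0 \<ge> 1" "max_modulus r0 f > exp (r0 powr (\<alpha> / 2))"
    using lower[of "\<alpha> / 2"] \<open>\<alpha> > 0\<close> unfolding eventually_at_top_linorder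
    by (metis half_gt_zero field_sum_of_halves less_add_same_cancel1 linorder_not_le)
  have gt1: "max_modulus r f > 1" if "r \<ge> r0" for r
  proof -
    have "1 < exp (r0 powr (\<alpha> / 2))" using r0 by simp
    also have "\<dots> < max_modulus r0 f" by fact
    also have "\<dots> \<le> max_modulus r f" using max_modulus_mono[OF f] r0 that by auto
    finally show ?thesis .
  qed
  show "growth_order f \<le> ereal \<alpha>"
  proof (rule ccontr)
    assume "\<not> growth_order f \<le> ereal \<alpha>"
    then obtain \<sigma> where \<sigma>: "\<alpha> < \<sigma>" "ereal \<sigma> < growth_order f"
      using ereal_dense2[of "ereal \<alpha>" "growth_order f"] by (auto simp: not_le)
    have "growth_order f \<le> ereal \<sigma>"
      unfolding growth_order_def
    proof (rule Limsup_bounded)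
      show "\<forall>\<^sub>F r in at_top. ereal (ln (ln (max_modulus r f)) / ln r) \<le> ereal \<sigma>"
        using upper[OF \<sigma>(1)] eventually_ge_at_top[of r0] eventually_gt_at_top[of 1]
      proof eventually_elim
        case (elim r)
        have "ln (max_modulus r f) \<le> r powr \<sigma>"
          using elim gt1[of r] by (metis ln_exp ln_le_cancel_iff exp_gt_zero less_trans zero_less_one)
        then have "ln (ln (max_modulus r f)) \<le> ln (r powr \<sigma>)"
          using gt1[of r] elim by (subst ln_le_cancel_iff) (auto intro: ln_gt_zero)
        also have "\<dots> = \<sigma> * ln r" using elim by (simp add: ln_powr)
        finally show ?case using elim by (simp add: divide_le_eq)
      qed
    qed
    with \<sigma> show False by simp
  qed
  show "ereal \<alpha> \<le> growth_order f"
  proof (rule ccontr)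
    assume "\<not> ereal \<alpha> \<le> growth_order f"
    then obtain \<sigma>' where \<sigma>': "\<sigma>' < \<alpha>" "growth_order f < ereal \<sigma>'"
      using ereal_dense2[of "growth_order f" "ereal \<alpha>"] by (auto simp: not_le)
    \<comment> \<open>\<open>lower\<close> speaks of positive exponents only, so a possibly negative
      \<open>\<sigma>'\<close> is raised to a positive value still below
      \<open>\<alpha>\<close>.\<close>
    define \<sigma> where "\<sigma> = max \<sigma>' (\<alpha> / 2)"
    have \<sigma>: "0 < \<sigma>" "\<sigma> < \<alpha>" using \<sigma>' \<open>\<alpha> > 0\<close> by (auto simp: \<sigma>_def)
    have "growth_order f < ereal \<sigma>"
      by (rule less_le_trans[OF \<sigma>'(2)]) (simp add: \<sigma>_def)
    then have "\<forall>\<^sub>F r in at_top. ereal (ln (ln (max_modulus r f)) / ln r) < ereal \<sigma>"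
      unfolding growth_order_def by (rule Limsup_lessD)
    then have "\<forall>\<^sub>F r in at_top. max_modulus r f \<le> exp (r powr \<sigma>)"
      using eventually_ge_at_top[of r0] eventually_gt_at_top[of 1]
    proof eventually_elim
      case (elim r)
      have pos: "ln (max_modulus r f) > 0" using gt1[of r] elim by simp
      have "ln (ln (max_modulus r f)) < \<sigma> * ln r"
        using elim by (simp add: divide_less_eq)
      then have "exp (ln (ln (max_modulus r f))) < exp (\<sigma> * ln r)" by (simp only: exp_less_mono)
      then have "ln (max_modulus r f) \<le> r powr \<sigma>"
        using pos elim by (simp add: powr_def)
      then show ?case using gt1[of r] elim
        by (metis exp_le_cancel_iff exp_ln less_trans zero_less_one)
    qed
    with lower[OF \<sigma>] show False by blast
  qed
qed

section \<open>Residues with an exponential kernel\<close>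

lemma has_contour_integral_residue_solution:
  assumes "\<psi> holomorphic_on ball 0 r - {0}" "0 < \<rho>" "\<rho> < r"
  shows "((\<lambda>t. \<psi> t * exp (- z * t)) has_contour_integral 2 * pi * \<i> * residue_solution \<psi> z)
           (circlepath 0 \<rho>)"
  unfolding residue_solution_def
  using assms by (intro base_residue[of "ball 0 r"] holomorphic_intros) auto

text \<open>The circle is centred at 0, so its path derivative is 2 pi i times the point itself and
  cancels the constant of the residue. Differentiation under the integral sign applies to this
  form.\<close>

lemma residue_solution_eq_integral:
  assumes "\<psi> holomorphic_on ball 0 r - {0}" "0 < \<rho>" "\<rho> < r"
  shows "residue_solution \<psi> z =
     integral (cbox 0 1) (\<lambda>x. \<psi> (circlepath 0 \<rho> x) * exp (- z * circlepath 0 \<rho> x) * circlepath 0 \<rho> x)"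
proof -
  let ?c = "circlepath 0 \<rho>"
  have "2 * pi * \<i> * residue_solution \<psi> z = contour_integral ?c (\<lambda>t. \<psi> t * exp (- z * t))"
    using has_contour_integral_residue_solution[OF assms]
    by (rule contour_integral_unique[symmetric])
  also have "\<dots> = integral (cbox 0 1) (\<lambda>x. 2 * pi * \<i> * (\<psi> (?c x) * exp (- z * ?c x) * ?c x))"
    unfolding contour_integral_integral vector_derivative_circlepath cbox_interval
    by (simp add: circlepath mult_ac)
  also have "\<dots> = 2 * pi * \<i> * integral (cbox 0 1) (\<lambda>x. \<psi> (?c x) * exp (- z * ?c x) * ?c x)"
    by (rule integral_mult_right)
  finally show ?thesis by simp
qed

text \<open>Differentiation under the integral sign: the circle of radius \<open>r / 2\<close> is
  independent of \<open>z\<close>, and the kernel contributes the factor -t.\<close>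

lemma has_field_derivative_residue_solution:
  assumes \<psi>: "\<psi> holomorphic_on ball 0 r - {0}" and "0 < r"
  shows "(residue_solution \<psi> has_field_derivative residue_solution (\<lambda>t. - t * \<psi> t) z) (at z)"
proof -
  define \<rho> where "\<rho> = r / 2"
  have \<rho>: "0 < \<rho>" "\<rho> < r" using \<open>0 < r\<close> by (auto simp: \<rho>_def)
  let ?c = "circlepath 0 \<rho>"
  have \<psi>': "(\<lambda>t. - t * \<psi> t) holomorphic_on ball 0 r - {0}"
    by (intro holomorphic_intros \<psi>)
  have cont: "continuous_on (cbox 0 1) (\<lambda>x. \<psi> (?c x))"
  proof (rule continuous_on_compose2[OF holomorphic_on_imp_continuous_on[OF \<psi>]])
    show "continuous_on (cbox 0 1) ?c" unfolding circlepath by (intro continuous_intros)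
    show "?c ` cbox 0 1 \<subseteq> ball 0 r - {0}"
      using \<rho> by (auto simp: circlepath norm_mult)
  qed
  have contc: "continuous_on S ?c" for S unfolding circlepath by (intro continuous_intros)
  have "((\<lambda>z. integral (cbox 0 1) (\<lambda>x. \<psi> (?c x) * exp (- z * ?c x) * ?c x)) has_field_derivative
      integral (cbox 0 1) (\<lambda>x. (- ?c x * \<psi> (?c x)) * exp (- z * ?c x) * ?c x)) (at z within UNIV)"
  proof (rule leibniz_rule_field_derivative)
    fix z :: complex and x :: real
    show "((\<lambda>z. \<psi> (?c x) * exp (- z * ?c x) * ?c x) has_field_derivative
        (- ?c x * \<psi> (?c x)) * exp (- z * ?c x) * ?c x) (at z within UNIV)"
      by (auto intro!: derivative_eq_intros)
  next
    fix z
    show "(\<lambda>x. \<psi> (?c x) * exp (- z * ?c x) * ?c x) integrable_on cbox 0 1"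
      by (intro integrable_continuous continuous_intros cont contc)
  next
    show "continuous_on (UNIV \<times> cbox 0 1)
        (\<lambda>(z, x). (- ?c x * \<psi> (?c x)) * exp (- z * ?c x) * ?c x)"
      unfolding case_prod_unfold
      by (intro continuous_intros continuous_on_compose2[OF cont] continuous_on_compose2[OF contc[of UNIV]]) auto
  qed auto
  then show ?thesis
    by (simp only: residue_solution_eq_integral[OF \<psi> \<rho>, abs_def] residue_solution_eq_integral[OF \<psi>' \<rho>])
qed

lemma higher_deriv_residue_solution:
  assumes "\<psi> holomorphic_on ball 0 r - {0}" and "0 < r"
  shows "(deriv ^^ k) (residue_solution \<psi>) = residue_solution (\<lambda>t. (- t) ^ k * \<psi> t)"
proof (induction k)
  case (Suc k)
  have "(\<lambda>t. (- t) ^ k * \<psi> t) holomorphic_on ball 0 r - {0}"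
    by (intro holomorphic_intros assms)
  from DERIV_imp_deriv[OF has_field_derivative_residue_solution[OF this \<open>0 < r\<close>]]
  show ?case by (auto simp: Suc fun_eq_iff mult_ac)
qed simp

lemma holomorphic_residue_solution:
  assumes "\<psi> holomorphic_on ball 0 r - {0}" and "0 < r"
  shows "residue_solution \<psi> holomorphic_on UNIV"
  using has_field_derivative_residue_solution[OF assms]
  by (auto simp: holomorphic_on_def field_differentiable_def intro: has_field_derivative_at_within)

text \<open>L[w](z) is a single contour integral over a circle, and its integrand has a primitive
  that is single-valued on the punctured ball.\<close>

lemma L_op_residue_solution_eq_0:
  assumes "0 < r" "q < n" and b: "\<And>j. q < j \<Longrightarrow> j < n \<Longrightarrow> b j = 0"
    and \<phi>: "\<phi> holomorphic_on ball 0 r - {0}"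
    and deriv: "\<And>t. t \<in> ball 0 r - {0} \<Longrightarrow>
      ((\<lambda>t. \<phi> t * Q1 q b t) has_field_derivative - Q0 n a t * \<phi> t) (at t)"
  shows "L_op n a b (residue_solution \<phi>) z = 0"
proof -
  define \<rho> where "\<rho> = r / 2"
  have \<rho>: "0 < \<rho>" "\<rho> < r" using \<open>0 < r\<close> by (auto simp: \<rho>_def)
  let ?c = "circlepath 0 \<rho>"
  define W where "W = (\<lambda>j. residue_solution (\<lambda>t. (- t) ^ j * \<phi> t) z)"
  have W: "((\<lambda>t. (- t) ^ j * \<phi> t * exp (- z * t)) has_contour_integral 2 * pi * \<i> * W j) ?c" for j
    unfolding W_def
    by (rule has_contour_integral_residue_solution[OF _ \<rho>]) (intro holomorphic_intros \<phi>)
  have "((\<lambda>t. (- t) ^ n * \<phi> t * exp (- z * t) +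
          (\<Sum>j<n. (a j + b j * z) * ((- t) ^ j * \<phi> t * exp (- z * t))))
        has_contour_integral (2 * pi * \<i> * W n + (\<Sum>j<n. (a j + b j * z) * (2 * pi * \<i> * W j)))) ?c"
    by (intro has_contour_integral_add has_contour_integral_sum has_contour_integral_lmul W) auto
  moreover have "2 * pi * \<i> * W n + (\<Sum>j<n. (a j + b j * z) * (2 * pi * \<i> * W j)) =
      2 * pi * \<i> * L_op n a b (residue_solution \<phi>) z"
    unfolding L_op_def higher_deriv_residue_solution[OF \<phi> \<open>0 < r\<close>] W_def
    by (simp add: distrib_left sum_distrib_left mult_ac)
  moreover have "((\<lambda>t. (- t) ^ n * \<phi> t * exp (- z * t) +
          (\<Sum>j<n. (a j + b j * z) * ((- t) ^ j * \<phi> t * exp (- z * t)))) has_contour_integral 0) ?c"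
  proof (rule Cauchy_theorem_primitive)
    fix t assume t: "t \<in> ball 0 r - {0::complex}"
    \<comment> \<open>The b_j with q < j < n vanish, so the sum may run over all j < n as in
      \<open>L_op\<close>.\<close>
    have Q1_eq: "Q1 q b t = (\<Sum>j<n. b j * (- t) ^ j)"
      unfolding Q1_def using \<open>q < n\<close> b by (intro sum.mono_neutral_left) (auto simp: not_le)
    have Q: "(- t) ^ n * \<phi> t * exp (- z * t) +
          (\<Sum>j<n. (a j + b j * z) * ((- t) ^ j * \<phi> t * exp (- z * t))) =
          (Q0 n a t + z * Q1 q b t) * \<phi> t * exp (- z * t)"
      unfolding Q0_def Q1_eq
      by (simp add: algebra_simps sum.distrib sum_distrib_left)
    have "((\<lambda>t. - (\<phi> t * Q1 q b t) * exp (- z * t)) has_field_derivative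
        (Q0 n a t + z * Q1 q b t) * \<phi> t * exp (- z * t)) (at t)"
      by (rule derivative_eq_intros deriv[OF t] refl | simp add: algebra_simps)+
    then show "((\<lambda>t. - (\<phi> t * Q1 q b t) * exp (- z * t)) has_field_derivative
        (- t) ^ n * \<phi> t * exp (- z * t) +
          (\<Sum>j<n. (a j + b j * z) * ((- t) ^ j * \<phi> t * exp (- z * t)))) (at t within ball 0 r - {0})"
      unfolding Q by (rule has_field_derivative_at_within)
  qed (use \<rho> in auto)
  ultimately show ?thesis
    by (auto dest: has_contour_integral_unique)
qed

section \<open>The principal part of the Laurent series\<close>

text \<open>The residue of t^k \<phi>(t) is the Laurent coefficient of t^-(k+1). The series arises
  by expanding 1 / (s - t) geometrically in t / s on a circle inside the one through s.\<close>

lemma laurent_principal_part_sums: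
  assumes \<phi>: "\<phi> holomorphic_on ball 0 r - {0}" and s: "s \<noteq> 0" "norm s < r"
  shows "(\<lambda>k. residue (\<lambda>t. t ^ k * \<phi> t) 0 / s ^ Suc k) sums residue (\<lambda>t. \<phi> t / (s - t)) 0"
proof -
  \<comment> \<open>On the circle of this radius |t / s| is exactly 1/2 and |s - t| is at least
    \<open>\<eta>\<close>.\<close>
  define \<eta> where "\<eta> = norm s / 2"
  have \<eta>: "0 < \<eta>" "\<eta> < norm s" using s by (auto simp: \<eta>_def)
  then have "\<eta> < r" using s by simp
  let ?c = "circlepath 0 \<eta>"
  define c where "c = (\<lambda>k. residue (\<lambda>t. t ^ k * \<phi> t) 0)"
  define I where "I = residue (\<lambda>t. \<phi> t / (s - t)) 0"
  have "compact (\<phi> ` sphere 0 \<eta>)"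
    using \<eta> \<open>\<eta> < r\<close> by (intro compact_continuous_image continuous_on_subset[OF holomorphic_on_imp_continuous_on[OF \<phi>]]) auto
  then obtain B where B: "B > 0" "\<And>t. norm t = \<eta> \<Longrightarrow> norm (\<phi> t) \<le> B"
    by (auto dest!: compact_imp_bounded simp: bounded_pos)
  have I: "((\<lambda>t. \<phi> t / (s - t)) has_contour_integral 2 * pi * \<i> * I) ?c"
    unfolding I_def using \<eta> s
    by (intro base_residue[of "ball 0 (norm s)"] holomorphic_intros holomorphic_on_subset[OF \<phi>]) auto
  have c: "((\<lambda>t. t ^ k * \<phi> t) has_contour_integral 2 * pi * \<i> * c k) ?c" for k
    unfolding c_def using \<eta> \<open>\<eta> < r\<close>
    by (intro base_residue[of "ball 0 r"] holomorphic_intros \<phi>) auto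
  \<comment> \<open>Removing K terms of the geometric series leaves the factor (t / s)^K in the
    integrand; the length of the circle cancels the \<open>\<eta>\<close> in the
    denominator.\<close>
  have bound: "norm (I - (\<Sum>k<K. c k / s ^ Suc k)) \<le> B * (1 / 2) ^ K" for K
  proof -
    have "((\<lambda>t. \<phi> t / (s - t) - (\<Sum>k<K. 1 / s ^ Suc k * (t ^ k * \<phi> t))) has_contour_integral
       2 * pi * \<i> * I - (\<Sum>k<K. 1 / s ^ Suc k * (2 * pi * \<i> * c k))) ?c"
      by (intro has_contour_integral_diff has_contour_integral_sum has_contour_integral_lmul I c) auto
    moreover have "norm (\<phi> t / (s - t) - (\<Sum>k<K. 1 / s ^ Suc k * (t ^ k * \<phi> t))) \<le> B / \<eta> * (1 / 2) ^ K"
      if t: "norm (t - 0) = \<eta>" for t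
    proof -
      have "s - t \<noteq> 0" "t \<noteq> 0" using t \<eta> by auto
      then have "t / s \<noteq> 1" using s by auto
      have "(\<Sum>k<K. 1 / s ^ Suc k * (t ^ k * \<phi> t)) = \<phi> t / s * (\<Sum>k<K. (t / s) ^ k)"
        unfolding sum_distrib_left by (intro sum.cong) (auto simp: power_divide)
      also have "\<dots> = \<phi> t / (s - t) * (1 - (t / s) ^ K)"
      proof -
        have "s - t = s * (1 - t / s)" using s by (simp add: algebra_simps)
        moreover have "(\<Sum>k<K. (t / s) ^ k) = (1 - (t / s) ^ K) / (1 - t / s)"
          using s \<open>s - t \<noteq> 0\<close> by (auto simp: sum_gp_strict)
        ultimately show ?thesis by simp
      qed
      finally have "\<phi> t / (s - t) - (\<Sum>k<K. 1 / s ^ Suc k * (t ^ k * \<phi> t)) = \<phi> t / (s - t) * (t / s) ^ K"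
        by (simp add: algebra_simps)
      moreover have "norm (\<phi> t / (s - t) * (t / s) ^ K) \<le> (B / \<eta>) * (1 / 2) ^ K"
      proof -
        have "norm (s - t) \<ge> \<eta>" using norm_triangle_ineq2[of s t] t by (simp add: \<eta>_def)
        have "norm (t / s) = 1 / 2" using t s by (simp add: \<eta>_def norm_divide)
        have "norm (\<phi> t) / norm (s - t) \<le> B / \<eta>"
          using B t \<open>norm (s - t) \<ge> \<eta>\<close> \<eta> by (intro frac_le) auto
        then show ?thesis
          unfolding norm_mult norm_power \<open>norm (t / s) = 1 / 2\<close> norm_divide[of "\<phi> t"]
          by (intro mult_right_mono) auto
      qed
      ultimately show ?thesis by simp
    qed
    ultimately have "norm (2 * pi * \<i> * I - (\<Sum>k<K. 1 / s ^ Suc k * (2 * pi * \<i> * c k)))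
        \<le> (B / \<eta> * (1 / 2) ^ K) * (2 * pi * \<eta>)"
      using B \<eta> by (intro has_contour_integral_bound_circlepath) auto
    moreover have "2 * pi * \<i> * I - (\<Sum>k<K. 1 / s ^ Suc k * (2 * pi * \<i> * c k)) =
        2 * pi * \<i> * (I - (\<Sum>k<K. c k / s ^ Suc k))"
      by (simp add: algebra_simps sum_distrib_left)
    ultimately have "norm (2 * pi * \<i> * (I - (\<Sum>k<K. c k / s ^ Suc k))) \<le> (B / \<eta> * (1 / 2) ^ K) * (2 * pi * \<eta>)"
      by (simp only:)
    then show ?thesis using \<eta> unfolding norm_mult by (simp add: field_simps)
  qed
  have "(\<lambda>K. B * (1 / 2) ^ K) \<longlonglongrightarrow> 0"
    by (intro tendsto_mult_right_zero LIMSEQ_power_zero) auto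
  then have "(\<lambda>K. I - (\<Sum>k<K. c k / s ^ Suc k)) \<longlonglongrightarrow> 0"
    by (rule Lim_null_comparison[rotated]) (rule always_eventually, rule allI, rule bound)
  then have "(\<lambda>K. \<Sum>k<K. c k / s ^ Suc k) \<longlonglongrightarrow> I"
    using tendsto_diff[OF tendsto_const[of I]] by fastforce
  then show ?thesis unfolding sums_def c_def I_def .
qed

text \<open>
  The residue at 0 of \<open>\<phi>(t) / (s - t)\<close> is the principal part of \<open>\<phi>\<close> evaluated at \<open>s\<close>.
\<close>

lemma bounded_laurent_regular_part:
  assumes \<phi>: "\<phi> holomorphic_on ball 0 r - {0}" and "0 < r"
  obtains B where "\<And>s. s \<noteq> 0 \<Longrightarrow> norm s < r / 4 \<Longrightarrow>
    norm (\<phi> s - residue (\<lambda>t. \<phi> t / (s - t)) 0) \<le> B"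
proof -
  define \<rho> where "\<rho> = r / 2"
  have \<rho>: "0 < \<rho>" "\<rho> < r" using \<open>0 < r\<close> by (auto simp: \<rho>_def)
  let ?c = "circlepath 0 \<rho>"
  have "compact (\<phi> ` sphere 0 \<rho>)"
    using \<rho> by (intro compact_continuous_image continuous_on_subset[OF holomorphic_on_imp_continuous_on[OF \<phi>]]) auto
  then obtain B where B: "B > 0" "\<And>t. norm t = \<rho> \<Longrightarrow> norm (\<phi> t) \<le> B"
    by (auto dest!: compact_imp_bounded simp: bounded_pos)
  have "norm (\<phi> s - residue (\<lambda>t. \<phi> t / (s - t)) 0) \<le> 2 * B" if s: "s \<noteq> 0" "norm s < r / 4" for s
  proof -
    have "norm s < r" using s \<open>0 < r\<close> by simp
    define f where "f = (\<lambda>t. \<phi> t / (s - t))"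
    have holo: "f holomorphic_on ball 0 r - {0, s}"
      unfolding f_def by (intro holomorphic_intros holomorphic_on_subset[OF \<phi>]) auto
    have path: "path_image ?c \<subseteq> ball 0 r - {0, s}"
      using \<rho> s by (auto simp: \<rho>_def)
    \<comment> \<open>Both 0 and s lie inside the circle, and the residue of \<open>f\<close> at s
      is -\<phi>(s). So the difference to be bounded is a contour integral over a circle at distance
      at least r / 4 from s.\<close>
    have "contour_integral ?c f = 2 * pi * \<i> * (\<Sum>p\<in>{0, s}. winding_number ?c p * residue f p)"
    proof (rule Residue_theorem[OF _ _ _ holo _ _ path])
      show "\<forall>z. z \<notin> ball 0 r \<longrightarrow> winding_number ?c z = 0"
        using \<rho> by (auto intro!: winding_number_zero_outside[of _ "cball 0 \<rho>"])
    qed auto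
    moreover have "residue f s = - \<phi> s"
    proof -
      have "residue (\<lambda>t. - \<phi> t / (t - s)) s = - \<phi> s"
        using s \<open>norm s < r\<close> by (intro residue_simple[of "ball 0 r - {0}"] holomorphic_intros \<phi>) auto
      moreover have "(\<lambda>t. - \<phi> t / (t - s)) = f"
        unfolding f_def by (auto simp: fun_eq_iff divide_simps algebra_simps)
      ultimately show ?thesis by simp
    qed
    moreover have "winding_number ?c s = 1" "winding_number ?c 0 = 1"
      using \<rho> s by (auto intro!: winding_number_circlepath simp: \<rho>_def)
    ultimately have eq: "contour_integral ?c f = 2 * pi * \<i> * (residue f 0 - \<phi> s)"
      using s by simp
    have "f contour_integrable_on ?c"
      by (rule contour_integrable_holomorphic_simple[OF holo _ _ path]) (auto intro: finite_imp_closed)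
    then have "(f has_contour_integral 2 * pi * \<i> * (residue f 0 - \<phi> s)) ?c"
      unfolding eq[symmetric] by (rule has_contour_integral_integral)
    moreover have "norm (f t) \<le> B / (\<rho> / 2)" if "norm (t - 0) = \<rho>" for t
    proof -
      have "norm (s - t) \<ge> \<rho> / 2"
        using norm_triangle_ineq2[of t s] that s by (simp add: \<rho>_def norm_minus_commute)
      then show ?thesis
        unfolding f_def norm_divide using B that \<rho> by (intro frac_le) auto
    qed
    ultimately have "norm (2 * pi * \<i> * (residue f 0 - \<phi> s)) \<le> B / (\<rho> / 2) * (2 * pi * \<rho>)"
      using B \<rho> by (intro has_contour_integral_bound_circlepath) auto
    then have "norm (residue f 0 - \<phi> s) \<le> 2 * B"
      using \<rho> unfolding norm_mult by (simp add: field_simps)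
    then show ?thesis by (simp add: f_def norm_minus_commute)
  qed
  with that show ?thesis by blast
qed

section \<open>From the growth of w to the growth of \<open>\<phi>\<close> near 0\<close>

text \<open>If x^(1 - \<sigma>) is at least 4B, the linear term absorbs B x^\<sigma>; otherwise x is
  bounded in terms of B, and the constant absorbs it. The slope 1/4 is small enough for exp(1/4) <
  2, which a later geometric series requires.\<close>

lemma powr_mult_le_young:
  fixes x B \<sigma> :: real
  assumes "0 < \<sigma>" "\<sigma> < 1" "0 < x" "0 < B"
  shows "B * x powr \<sigma> \<le> x / 4 + (4 * B) powr (1 / (1 - \<sigma>))"
proof (cases "4 * B \<le> x powr (1 - \<sigma>)")
  case True
  have "4 * B * x powr \<sigma> \<le> x powr (1 - \<sigma>) * x powr \<sigma>"
    by (intro mult_right_mono True) auto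
  also have "\<dots> = x" using assms by (simp flip: powr_add)
  finally have "B * x powr \<sigma> \<le> x / 4" by simp
  also have "\<dots> \<le> x / 4 + (4 * B) powr (1 / (1 - \<sigma>))" by simp
  finally show ?thesis .
next
  case False
  have "x = (x powr (1 - \<sigma>)) powr (1 / (1 - \<sigma>))" using assms by (simp add: powr_powr)
  also have "\<dots> \<le> (4 * B) powr (1 / (1 - \<sigma>))" using False assms by (intro powr_mono2) auto
  finally have "x powr \<sigma> \<le> ((4 * B) powr (1 / (1 - \<sigma>))) powr \<sigma>"
    using assms by (intro powr_mono2) auto
  then have "B * x powr \<sigma> \<le> (4 * B) powr 1 * (4 * B) powr (\<sigma> / (1 - \<sigma>))"
    using assms by (intro mult_mono) (auto simp: powr_powr)
  also have "\<dots> = (4 * B) powr (1 / (1 - \<sigma>))"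
  proof -
    have "1 + \<sigma> / (1 - \<sigma>) = 1 / (1 - \<sigma>)" using assms by (simp add: field_simps)
    then show ?thesis unfolding powr_add[symmetric] by simp
  qed
  also have "\<dots> \<le> x / 4 + (4 * B) powr (1 / (1 - \<sigma>))" using assms by simp
  finally show ?thesis .
qed

text \<open>Up to sign, the Laurent coefficient of t^-(k+1) is the k-th derivative of w at 0.
  Cauchy's inequality at a radius depending on k and s dominates the principal part at s by a
  geometric series; the exponent \<sigma> / (1 - \<sigma>) comes from the Young-type
  inequality.\<close>

lemma norm_le_if_growth_residue_solution:
  assumes \<phi>: "\<phi> holomorphic_on ball 0 r - {0}" and "0 < r" and \<sigma>: "0 < \<sigma>" "\<sigma> < 1"
    and growth: "\<forall>\<^sub>F R in at_top. max_modulus R (residue_solution \<phi>) \<le> exp (R powr \<sigma>)"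
  obtains A C \<kappa> where "\<And>s. s \<noteq> 0 \<Longrightarrow> norm s < r / 4 \<Longrightarrow>
     norm (\<phi> s) \<le> A + C / norm s * exp (\<kappa> * norm s powr (- (\<sigma> / (1 - \<sigma>))))"
proof -
  define w where "w = residue_solution \<phi>"
  have w: "w holomorphic_on UNIV"
    unfolding w_def using \<phi> \<open>0 < r\<close> by (rule holomorphic_residue_solution)
  note w_cont = holomorphic_on_imp_continuous_on[OF w]
  obtain R0 where R0: "\<And>R. R \<ge> R0 \<Longrightarrow> max_modulus R w \<le> exp (R powr \<sigma>)"
    using growth unfolding eventually_at_top_linorder w_def by blast
  \<comment> \<open>The factor makes one bound valid at all positive radii, including those below
    \<open>R0\<close>.\<close>
  define K where "K = max 1 (max_modulus R0 w)"
  have M: "max_modulus R w \<le> K * exp (R powr \<sigma>)" if "R > 0" for R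
  proof (cases "R \<ge> R0")
    case True
    have "max_modulus R w \<le> 1 * exp (R powr \<sigma>)" using R0[OF True] by simp
    also have "\<dots> \<le> K * exp (R powr \<sigma>)" by (intro mult_right_mono) (auto simp: K_def)
    finally show ?thesis .
  next
    case False
    have "max_modulus R w \<le> max_modulus R0 w"
      using False that by (intro max_modulus_mono w) auto
    also have "\<dots> \<le> K * 1" by (simp add: K_def)
    also have "\<dots> \<le> K * exp (R powr \<sigma>)" by (intro mult_left_mono) (auto simp: K_def)
    finally show ?thesis .
  qed
  define c where "c = (\<lambda>k. residue (\<lambda>t. t ^ k * \<phi> t) 0)"
  have c_eq: "norm (c k) = norm ((deriv ^^ k) w 0)" for k
  proof -
    have "(deriv ^^ k) w 0 = residue (\<lambda>t. (- 1) ^ k * (t ^ k * \<phi> t)) 0"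
      unfolding w_def higher_deriv_residue_solution[OF \<phi> \<open>0 < r\<close>] residue_solution_def
      by (simp flip: power_mult_distrib mult.assoc)
    also have "\<dots> = (- 1) ^ k * c k"
      unfolding c_def using \<open>0 < r\<close>
      by (intro residue_lmul[of "ball 0 r"] holomorphic_intros \<phi>) auto
    finally show ?thesis by (simp add: norm_mult norm_power)
  qed
  have c_le: "norm (c k) \<le> fact k * (K * exp (R powr \<sigma>)) / R ^ k" if "R > 0" for k R
    unfolding c_eq
  proof (rule Cauchy_inequality)
    show "norm (w z) \<le> K * exp (R powr \<sigma>)" if "norm (0 - z) = R" for z
      using norm_le_max_modulus[OF w_cont, of z R] M[of R] that \<open>R > 0\<close> by simp
  qed (use that in \<open>auto intro: holomorphic_on_subset[OF w] continuous_on_subset[OF w_cont]\<close>)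
  obtain A where A: "\<And>s. s \<noteq> 0 \<Longrightarrow> norm s < r / 4 \<Longrightarrow>
    norm (\<phi> s - residue (\<lambda>t. \<phi> t / (s - t)) 0) \<le> A"
    using bounded_laurent_regular_part[OF \<phi> \<open>0 < r\<close>] by blast
  \<comment> \<open>Ratio of the dominating geometric series: exp(1/4) from the Young-type
    inequality, 1/2 from the Cauchy radius.\<close>
  define x where "x = exp (1 / 4) / (2 :: real)"
  have "exp (1 / 4 :: real) ^ 4 < 2 ^ 4"
    using exp_le by (simp flip: exp_of_nat_mult)
  then have "exp (1 / 4 :: real) < 2"
    by (rule power_less_imp_less_base) simp
  then have x: "0 < x" "x < 1" by (auto simp: x_def)
  define \<kappa> where "\<kappa> = (4 * 2 powr \<sigma>) powr (1 / (1 - \<sigma>))"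
  have "norm (\<phi> s) \<le> A + (K * exp (1 / 4) / (1 - x)) / norm s * exp (\<kappa> * norm s powr (- (\<sigma> / (1 - \<sigma>))))"
    if s: "s \<noteq> 0" "norm s < r / 4" for s
  proof -
    define \<delta> where "\<delta> = norm s"
    have \<delta>: "\<delta> > 0" using s by (simp add: \<delta>_def)
    define E where "E = exp (\<kappa> * \<delta> powr (- (\<sigma> / (1 - \<sigma>))))"
    have term_le: "norm (c k / s ^ Suc k) \<le> K * exp (1 / 4) / \<delta> * E * x ^ k" for k
    proof -
      \<comment> \<open>With this radius k! / R^k is at most (\<delta> / 2)^k: the powers of
        \<delta> cancel those of s in the series, and the remaining 2^-k beats exp(k / 4).\<close>
      define R where "R = 2 * real (Suc k) / \<delta>"
      have "R > 0" using \<delta> by (simp add: R_def)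
      have "R powr \<sigma> = (2 / \<delta>) powr \<sigma> * real (Suc k) powr \<sigma>"
        unfolding R_def using \<delta> by (subst powr_mult[symmetric]) (auto simp: mult_ac)
      also have "\<dots> \<le> real (Suc k) / 4 + (4 * (2 / \<delta>) powr \<sigma>) powr (1 / (1 - \<sigma>))"
        using \<sigma> \<delta> by (intro powr_mult_le_young) auto
      also have "(4 * (2 / \<delta>) powr \<sigma>) powr (1 / (1 - \<sigma>)) = \<kappa> * \<delta> powr (- (\<sigma> / (1 - \<sigma>)))"
        using \<delta> by (simp add: \<kappa>_def powr_divide powr_mult powr_powr powr_minus field_simps)
      finally have "exp (R powr \<sigma>) \<le> exp (real (Suc k) / 4 + \<kappa> * \<delta> powr (- (\<sigma> / (1 - \<sigma>))))"
        by simp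
      also have "\<dots> = exp (1 / 4) * exp (1 / 4) ^ k * E"
        unfolding E_def exp_add[symmetric] exp_of_nat_mult[symmetric] by (simp add: field_simps)
      finally have 1: "exp (R powr \<sigma>) \<le> exp (1 / 4) * exp (1 / 4) ^ k * E" .
      have "fact k \<le> real (k ^ k)" by (rule fact_le_power)
      also have "\<dots> \<le> real (Suc k) ^ k" unfolding of_nat_power by (intro power_mono) auto
      finally have "fact k \<le> real (Suc k) ^ k" .
      have 2: "fact k / R ^ k \<le> \<delta> ^ k / 2 ^ k"
      proof -
        have "R ^ k = 2 ^ k * real (Suc k) ^ k / \<delta> ^ k"
          by (simp only: R_def power_divide power_mult_distrib)
        then have "fact k / R ^ k = fact k / real (Suc k) ^ k * (\<delta> ^ k / 2 ^ k)" by simp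
        also have "\<dots> \<le> 1 * (\<delta> ^ k / 2 ^ k)"
          using \<delta> \<open>fact k \<le> real (Suc k) ^ k\<close> by (intro mult_right_mono) (auto simp: divide_le_eq)
        finally show ?thesis by simp
      qed
      have "norm (c k / s ^ Suc k) = norm (c k) / \<delta> ^ Suc k"
        by (simp add: norm_divide norm_mult norm_power \<delta>_def)
      also have "\<dots> \<le> (fact k * (K * exp (R powr \<sigma>)) / R ^ k) / \<delta> ^ Suc k"
        using c_le[OF \<open>R > 0\<close>] \<delta> by (intro divide_right_mono) auto
      also have "\<dots> = (fact k / R ^ k) * (K * exp (R powr \<sigma>)) / \<delta> ^ Suc k" by simp
      also have "\<dots> \<le> (\<delta> ^ k / 2 ^ k) * (K * (exp (1 / 4) * exp (1 / 4) ^ k * E)) / \<delta> ^ Suc k"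
        using \<delta> by (intro divide_right_mono mult_mono 1 2) (auto simp: K_def)
      also have "\<dots> = K * exp (1 / 4) / \<delta> * E * x ^ k"
        using \<delta> by (simp add: x_def power_divide field_simps)
      finally show ?thesis .
    qed
    have "norm s < r" using s \<open>0 < r\<close> by simp
    then have sums: "(\<lambda>k. c k / s ^ Suc k) sums residue (\<lambda>t. \<phi> t / (s - t)) 0"
      unfolding c_def by (rule laurent_principal_part_sums[OF \<phi> s(1)])
    have gs: "(\<lambda>k. K * exp (1 / 4) / \<delta> * E * x ^ k) sums (K * exp (1 / 4) / \<delta> * E * (1 / (1 - x)))"
      using x by (intro sums_mult geometric_sums) auto
    have "norm (residue (\<lambda>t. \<phi> t / (s - t)) 0) \<le> K * exp (1 / 4) / \<delta> * E * (1 / (1 - x))"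
      using norm_suminf_le[OF term_le sums_summable[OF gs]] sums_unique[OF sums] sums_unique[OF gs]
      by simp
    moreover have "norm (\<phi> s) \<le> norm (\<phi> s - residue (\<lambda>t. \<phi> t / (s - t)) 0) + norm (residue (\<lambda>t. \<phi> t / (s - t)) 0)"
      using norm_triangle_ineq[of "\<phi> s - residue (\<lambda>t. \<phi> t / (s - t)) 0" "residue (\<lambda>t. \<phi> t / (s - t)) 0"] by simp
    ultimately show ?thesis
      using A[OF s] by (simp add: E_def \<delta>_def mult_ac)
  qed
  then show ?thesis by (rule that)
qed

section \<open>Normal form of the branches\<close>

text \<open>A pole at 0 forces b_0 = Q1(0) = 0, and then a_0 = Q0(0) is non-zero because a_0 + b_0 z
  does not vanish identically. So nothing cancels at 0, and the pole order is the order of the zero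
  of Q1.\<close>

lemma Q1_eq_power_times_poly:
  assumes "n \<ge> 1" and not0: "\<not> (\<forall>z. a 0 + b 0 * z = 0)"
    and pole: "is_pole (\<lambda>t. Q0 n a t / Q1 q b t) 0"
    and zorder: "zorder (\<lambda>t. Q0 n a t / Q1 q b t) 0 = - int p"
  obtains Q where "\<And>t. Q1 q b t = t ^ p * poly Q t" "poly Q 0 \<noteq> 0" "Q0 n a 0 \<noteq> 0"
proof -
  define P where "P = (\<Sum>j\<le>q. smult (b j) ([:0, -1:] ^ j))"
  have P: "poly P t = Q1 q b t" for t
    by (simp add: P_def Q1_def poly_sum poly_power)
  have Q0_0: "Q0 n a 0 = a 0"
    using \<open>n \<ge> 1\<close> by (cases n) (simp_all add: Q0_def sum.lessThan_Suc_shift del: sum.lessThan_Suc)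
  have Q0_holo: "Q0 n a holomorphic_on A" for A
    unfolding Q0_def by (intro holomorphic_intros)
  \<comment> \<open>Division by zero yields 0, so a vanishing Q1 would make the quotient the zero
    function, which has no pole.\<close>
  have "P \<noteq> 0"
  proof
    assume "P = 0"
    then have "Q1 q b = (\<lambda>_. 0)" using P by (auto simp: fun_eq_iff)
    then show False using pole by simp
  qed
  then obtain Q where Q: "P = [:0, 1:] ^ order 0 P * Q" "\<not> [:0, 1:] dvd Q"
    using order_decomp[of P 0] by auto
  define m where "m = order 0 P"
  have Q1_eq: "Q1 q b t = t ^ m * poly Q t" for t
    using arg_cong[OF Q(1), of "\<lambda>p. poly p t"] by (simp add: P poly_power m_def)
  have Q_0: "poly Q 0 \<noteq> 0"
    using Q(2) by (simp add: poly_eq_0_iff_dvd)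
  define A where "A = {t. poly Q t \<noteq> 0}"
  have A: "open A" "0 \<in> A"
    unfolding A_def using Q_0 by (auto intro!: open_Collect_neq continuous_intros)
  have holo: "(\<lambda>t. Q0 n a t / poly Q t) holomorphic_on A"
    by (intro holomorphic_intros Q0_holo) (auto simp: A_def)
  have "m \<noteq> 0"
  proof
    assume "m = 0"
    then have "(\<lambda>t. Q0 n a t / Q1 q b t) holomorphic_on A" using holo by (simp add: Q1_eq)
    then show False using not_is_pole_holomorphic A pole by blast
  qed
  then have "b 0 = 0"
    using Q1_eq[of 0] by (cases q) (simp_all add: Q1_def sum.atMost_Suc_shift del: sum.atMost_Suc)
  then have Q0_nz: "Q0 n a 0 \<noteq> 0" using not0 Q0_0 by auto
  have "zorder (\<lambda>t. Q0 n a t / Q1 q b t) 0 = - int m"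
    using A holo Q0_nz Q_0
    by (intro zorder_eqI[of A]) (auto simp: Q1_eq power_int_minus field_simps)
  then have "m = p" using zorder by simp
  with Q1_eq Q_0 Q0_nz that show ?thesis by blast
qed

text \<open>Integrate the Taylor series of g divided by t^(m+1) termwise. The coefficient of 1 / t
  is the residue and cancels against c / t, the terms before it give T(t) / t^m, and those after it
  a holomorphic function.\<close>

lemma antiderivative_normal_form:
  assumes g: "g holomorphic_on ball 0 r" "g 0 \<noteq> 0" and "0 < r"
    and res: "residue (\<lambda>t. g t / t ^ Suc m) 0 = c"
  obtains T H where "T holomorphic_on ball 0 r" "H holomorphic_on ball 0 r" "m > 0 \<Longrightarrow> T 0 \<noteq> 0"
    "\<And>t. t \<in> ball 0 r - {0} \<Longrightarrow>
       ((\<lambda>t. T t / t ^ m + H t) has_field_derivative c / t - g t / t ^ Suc m) (at t)"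
proof -
  define e where "e = (\<lambda>k. (deriv ^^ k) g 0 / fact k)"
  have e_sums: "(\<lambda>k. e k * t ^ k) sums g t" if "t \<in> ball 0 r" for t
    using holomorphic_power_series[OF g(1) that] by (simp add: e_def)
  have c: "c = e m"
    using residue_holomorphic_over_power'[of "ball 0 r" g m] g \<open>0 < r\<close> res by (simp add: e_def)
  \<comment> \<open>The Taylor series of g beyond t^m, divided by t^(m+1).\<close>
  define h where "h = (\<lambda>t. \<Sum>k. e (k + Suc m) * t ^ k)"
  have h_sums: "(\<lambda>k. e (k + Suc m) * t ^ k) sums h t" if t: "t \<in> ball 0 r" for t
  proof (cases "t = 0")
    case True
    then show ?thesis unfolding h_def by (intro summable_sums) (auto intro!: summable_finite[of "{0}"])
  next
    case False
    have "summable (\<lambda>k. e (k + Suc m) * t ^ (k + Suc m))"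
      using sums_summable[OF e_sums[OF t]] by (subst summable_iff_shift)
    then have "summable (\<lambda>k. e (k + Suc m) * t ^ (k + Suc m) / t ^ Suc m)"
      by (rule summable_divide)
    moreover have "e (k + Suc m) * t ^ (k + Suc m) / t ^ Suc m = e (k + Suc m) * t ^ k" for k
      using False by (simp add: power_add)
    ultimately show ?thesis unfolding h_def by (simp add: summable_sums)
  qed
  have g_eq: "g t = (\<Sum>k<Suc m. e k * t ^ k) + t ^ Suc m * h t" if t: "t \<in> ball 0 r" for t
  proof -
    have "(\<lambda>k. t ^ Suc m * (e (k + Suc m) * t ^ k)) sums (t ^ Suc m * h t)"
      by (rule sums_mult[OF h_sums[OF t]])
    also have "(\<lambda>k. t ^ Suc m * (e (k + Suc m) * t ^ k)) = (\<lambda>k. e (k + Suc m) * t ^ (k + Suc m))"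
      by (simp add: power_add mult_ac)
    finally have "(\<lambda>k. e k * t ^ k) sums (t ^ Suc m * h t + (\<Sum>k<Suc m. e k * t ^ k))"
      by (subst (asm) sums_iff_shift)
    then show ?thesis using sums_unique2[OF e_sums[OF t]] by (simp add: add.commute)
  qed
  have "h holomorphic_on ball 0 r"
    using h_sums by (intro power_series_holomorphic[where a = "\<lambda>k. e (k + Suc m)"]) simp
  then obtain H where H: "\<And>t. t \<in> ball 0 r \<Longrightarrow> (H has_field_derivative h t) (at t)"
    using holomorphic_convex_primitive'[of "ball 0 r" h] by (auto simp: at_within_open[OF _ open_ball])
  \<comment> \<open>A primitive of -e_k t^(k-m-1) is e_k / (m - k) t^(k-m). In particular T(0) =
    g(0) / m if m > 0.\<close>
  define T where "T = (\<lambda>t. \<Sum>k<m. e k / of_nat (m - k) * t ^ k)"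
  show ?thesis
  proof (rule that[of T "\<lambda>t. - H t"])
    show "T holomorphic_on ball 0 r" unfolding T_def by (intro holomorphic_intros)
    have "H holomorphic_on ball 0 r" using H holomorphic_on_open open_ball by blast
    then show "(\<lambda>t. - H t) holomorphic_on ball 0 r" by (intro holomorphic_intros)
    show "T 0 \<noteq> 0" if "m > 0"
    proof -
      have "T 0 = (\<Sum>k\<in>{0}. e k / of_nat (m - k) * 0 ^ k)"
        unfolding T_def using that by (intro sum.mono_neutral_right) auto
      then show ?thesis using that g by (simp add: e_def)
    qed
    fix t :: complex assume t: "t \<in> ball 0 r - {0}"
    have "((\<lambda>t. (\<Sum>k<m. e k / of_nat (m - k) * inverse (t ^ (m - k))) + - H t) has_field_derivative
        (\<Sum>k<m. - (e k * t ^ k / t ^ Suc m)) + - h t) (at t)"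
    proof (intro DERIV_add DERIV_sum DERIV_minus H)
      fix k assume "k \<in> {..<m}"
      then obtain i where i: "m = k + Suc i" using less_iff_Suc_add[of k m] by auto
      have eq: "e k / of_nat (m - k) * - (of_nat (m - k) * t ^ (m - k - Suc 0) / (t ^ (m - k) * t ^ (m - k))) =
          - (e k * t ^ k / t ^ Suc m)"
        using t unfolding i by (simp add: divide_simps power_add del: of_nat_Suc)
      show "((\<lambda>t. e k / of_nat (m - k) * inverse (t ^ (m - k))) has_field_derivative
          - (e k * t ^ k / t ^ Suc m)) (at t)"
        unfolding eq[symmetric] using t
        by (auto intro!: derivative_eq_intros simp: divide_simps)
    qed (use t in auto)
    also have "(\<Sum>k<m. - (e k * t ^ k / t ^ Suc m)) + - h t = c / t - g t / t ^ Suc m"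
      using t by (subst g_eq) (auto simp: c sum_negf sum_divide_distrib add_divide_distrib)
    finally show "((\<lambda>t. T t / t ^ m + - H t) has_field_derivative c / t - g t / t ^ Suc m) (at t)"
    proof (rule has_field_derivative_transform_within_open[OF _ _ t])
      fix x :: complex assume x: "x \<in> ball 0 r - {0}"
      have "e k / of_nat (m - k) * inverse (x ^ (m - k)) = e k / of_nat (m - k) * x ^ k / x ^ m" if "k < m" for k
        using x that by (simp add: power_diff divide_simps)
      then show "(\<Sum>k<m. e k / of_nat (m - k) * inverse (x ^ (m - k))) + - H x = T x / x ^ m + - H x"
        by (simp add: T_def sum_divide_distrib)
    qed auto
  qed
qed

text \<open>Replaces the local antiderivatives by a linear differential equation that holds at every
  point of S.\<close>

lemma phi_L_branch_D:
  assumes "phi_L_branch n q a b S \<phi>" "t \<in> S"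
  shows "Q1 q b t \<noteq> 0" "\<phi> t \<noteq> 0"
    "((\<lambda>t. \<phi> t * Q1 q b t) has_field_derivative - Q0 n a t * \<phi> t) (at t)"
proof -
  obtain U F where U: "open U" "t \<in> U" and *: "\<forall>t\<in>U. Q1 q b t \<noteq> 0 \<and>
      (F has_field_derivative Q0 n a t / Q1 q b t) (at t) \<and> \<phi> t = 1 / Q1 q b t * exp (- F t)"
    using assms(1)[unfolded phi_L_branch_def, THEN conjunct2, THEN bspec, OF assms(2)] by (elim exE conjE)
  note F = *[rule_format, THEN conjunct1] *[rule_format, THEN conjunct2, THEN conjunct1]
    *[rule_format, THEN conjunct2, THEN conjunct2]
  show "Q1 q b t \<noteq> 0" "\<phi> t \<noteq> 0" using F U by auto
  have "((\<lambda>t. exp (- F t)) has_field_derivative - Q0 n a t * \<phi> t) (at t)"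
    using U F by (auto intro!: derivative_eq_intros F(2))
  then show "((\<lambda>t. \<phi> t * Q1 q b t) has_field_derivative - Q0 n a t * \<phi> t) (at t)"
    by (rule has_field_derivative_transform_within_open[OF _ U]) (use F in auto)
qed

text \<open>By the differential equation, \<phi> Q1 t^l exp(-G) has derivative 0 on the connected
  punctured ball. Its constant value is the free factor of the branch, non-zero because \<phi> and
  Q1 have no zeros there.\<close>

lemma phi_L_branch_normal_form:
  assumes branch: "phi_L_branch n q a b (ball 0 r - {0}) \<phi>" and "0 < r"
    and Q1: "\<And>t. Q1 q b t = t ^ p * Q t"
    and TH: "\<And>t. t \<in> ball 0 r - {0} \<Longrightarrow>
       ((\<lambda>t. T t / t ^ m + H t) has_field_derivative of_int l / t - Q0 n a t / Q1 q b t) (at t)"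
  obtains c where "c \<noteq> 0"
    "\<And>t. t \<in> ball 0 r - {0} \<Longrightarrow>
       \<phi> t = t powi (- (int p + l)) * (c * exp (H t) / Q t) * exp (T t / t ^ m)"
proof -
  let ?S = "ball 0 r - {0 :: complex}"
  define G where "G = (\<lambda>t. T t / t ^ m + H t)"
  note G = TH[folded G_def]
  define v where "v = (\<lambda>t. \<phi> t * Q1 q b t)"
  define u where "u = (\<lambda>t. v t * t powi l * exp (- G t))"
  have u: "(u has_field_derivative 0) (at t)" if t: "t \<in> ?S" for t
  proof -
    note D = phi_L_branch_D[OF branch t]
    have "(u has_field_derivative
       (- Q0 n a t * \<phi> t * t powi l + v t * (of_int l * t powi (l - 1))) * exp (- G t)
        + v t * t powi l * (exp (- G t) * - (of_int l / t - Q0 n a t / Q1 q b t))) (at t)"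
      unfolding u_def using t by (auto intro!: derivative_eq_intros D(3)[folded v_def] G)
    also have "(- Q0 n a t * \<phi> t * t powi l + v t * (of_int l * t powi (l - 1))) * exp (- G t)
        + v t * t powi l * (exp (- G t) * - (of_int l / t - Q0 n a t / Q1 q b t)) = 0"
      using t D(1) by (simp add: v_def power_int_diff divide_simps) (simp add: algebra_simps)
    finally show ?thesis .
  qed
  have conn: "connected ?S"
    by (intro connected_open_delete) auto
  have opn: "open ?S" by (rule open_delete[OF open_ball])
  have cont: "continuous_on ?S u"
    by (rule DERIV_continuous_on[OF has_field_derivative_at_within[OF u]])
  have deriv: "\<forall>t\<in>?S - {}. (u has_field_derivative 0) (at t)" using u by blast
  obtain c where c: "\<And>t. t \<in> ?S \<Longrightarrow> u t = c"
    using DERIV_zero_connected_constant[OF conn opn finite.emptyI cont deriv] by blast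
  obtain t0 where t0: "t0 \<in> ?S"
    using \<open>0 < r\<close> by (intro that[of "of_real (r / 2)"]) (auto simp: norm_divide)
  have "u t0 \<noteq> 0"
    using phi_L_branch_D[OF branch t0] t0 by (simp add: u_def v_def)
  show ?thesis
  proof (rule that[of c])
    show "c \<noteq> 0" using c[OF t0] \<open>u t0 \<noteq> 0\<close> by simp
    fix t assume t: "t \<in> ?S"
    note D = phi_L_branch_D[OF branch t]
    have "Q t \<noteq> 0" using D(1) by (auto simp: Q1)
    have "\<phi> t * (t ^ p * Q t) * t powi l = c * exp (G t)"
      using c[OF t] unfolding u_def v_def by (simp add: Q1 exp_minus field_simps)
    moreover have eq: "t powi (- (int p + l)) = inverse (t ^ p) * inverse (t powi l)"
      unfolding power_int_minus using t by (simp add: power_int_add)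
    ultimately show "\<phi> t = t powi (- (int p + l)) * (c * exp (H t) / Q t) * exp (T t / t ^ m)"
      unfolding eq using t \<open>Q t \<noteq> 0\<close> by (simp add: G_def exp_add field_simps)
  qed
qed

text \<open>As the residue l is an integer, the factor exp(-l log t) is the single-valued power
  \<open>t powi (- l)\<close>, so the formula makes sense on the whole punctured ball.\<close>

lemma phi_L_branch_ex:
  assumes Q1: "\<And>t. Q1 q b t = t ^ p * Q t"
    and Q: "Q holomorphic_on ball 0 r" "\<And>t. t \<in> ball 0 r \<Longrightarrow> Q t \<noteq> 0"
    and T: "T holomorphic_on ball 0 r" and H: "H holomorphic_on ball 0 r"
    and TH: "\<And>t. t \<in> ball 0 r - {0} \<Longrightarrow>
       ((\<lambda>t. T t / t ^ m + H t) has_field_derivative of_int l / t - Q0 n a t / Q1 q b t) (at t)"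
  shows "phi_L_branch n q a b (ball 0 r - {0})
    (\<lambda>t. t powi (- (int p + l)) * (exp (H t) / Q t) * exp (T t / t ^ m))"
  unfolding phi_L_branch_def
proof (intro conjI ballI)
  let ?S = "ball 0 r - {0 :: complex}"
  show "(\<lambda>t. t powi (- (int p + l)) * (exp (H t) / Q t) * exp (T t / t ^ m)) holomorphic_on ?S"
    using Q by (intro holomorphic_intros holomorphic_on_subset[OF Q(1)] holomorphic_on_subset[OF T]
      holomorphic_on_subset[OF H]) auto
  fix s assume s: "s \<in> ?S"
  \<comment> \<open>In the disc of radius |s| about s the quotient t / s has positive real part, so
    \<open>Ln (t / s)\<close> is holomorphic there.\<close>
  define U where "U = ball s (norm s) \<inter> ?S"
  define G where "G = (\<lambda>t. T t / t ^ m + H t)"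
  note G = TH[folded G_def]
  \<comment> \<open>The constant \<open>Ln s\<close> makes the sum of logarithms a logarithm of t
    itself, so that no constant factor is left over.\<close>
  define F where "F = (\<lambda>t. of_int l * (Ln (t / s) + Ln s) - G t)"
  have "open U" unfolding U_def by (intro open_Int open_delete) auto
  moreover have "s \<in> U" using s by (simp add: U_def)
  moreover have "U \<subseteq> ?S" by (auto simp: U_def)
  moreover have "\<forall>t\<in>U. Q1 q b t \<noteq> 0 \<and> (F has_field_derivative Q0 n a t / Q1 q b t) (at t) \<and>
    t powi (- (int p + l)) * (exp (H t) / Q t) * exp (T t / t ^ m) = 1 / Q1 q b t * exp (- F t)"
  proof (intro ballI conjI)
    fix t assume t: "t \<in> U"
    then have nz: "t \<noteq> 0" "s \<noteq> 0" "Q t \<noteq> 0" and tS: "t \<in> ?S" using s Q by (auto simp: U_def)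
    show "Q1 q b t \<noteq> 0" using nz by (simp add: Q1)
    have "norm (t / s - 1) < 1"
    proof -
      have "t / s - 1 = (t - s) / s" using nz by (simp add: field_simps)
      then show ?thesis using t nz by (simp add: U_def norm_divide dist_norm norm_minus_commute)
    qed
    then have "Re (t / s) > 0"
      using abs_Re_le_cmod[of "t / s - 1"] by simp
    then have "t / s \<notin> \<real>\<^sub>\<le>\<^sub>0" by (auto simp: complex_nonpos_Reals_iff)
    then show "(F has_field_derivative Q0 n a t / Q1 q b t) (at t)"
      unfolding F_def using nz by (auto intro!: derivative_eq_intros G[OF tS])
    have "exp (- F t) = inverse (exp (of_int l * (Ln (t / s) + Ln s))) * exp (G t)"
      unfolding F_def by (simp add: exp_diff exp_minus field_simps)
    also have "exp (of_int l * (Ln (t / s) + Ln s)) = t powi l"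
      using nz by (simp add: exp_power_int[symmetric] exp_add)
    finally have 1: "exp (- F t) = inverse (t powi l) * exp (G t)" .
    have 2: "t powi (- (int p + l)) = inverse (t ^ p) * inverse (t powi l)"
      unfolding power_int_minus using nz by (simp add: power_int_add)
    have 3: "exp (G t) = exp (T t / t ^ m) * exp (H t)" by (simp add: G_def exp_add)
    show "t powi (- (int p + l)) * (exp (H t) / Q t) * exp (T t / t ^ m) = 1 / Q1 q b t * exp (- F t)"
      unfolding 1 2 3 Q1 using nz by (simp add: divide_simps)
  qed
  ultimately show "\<exists>U F. open U \<and> s \<in> U \<and> U \<subseteq> ?S \<and>
    (\<forall>t\<in>U. Q1 q b t \<noteq> 0 \<and> (F has_field_derivative Q0 n a t / Q1 q b t) (at t) \<and>
    t powi (- (int p + l)) * (exp (H t) / Q t) * exp (T t / t ^ m) = 1 / Q1 q b t * exp (- F t))"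
    by (intro exI[of _ U] exI[of _ F] conjI)
qed

section \<open>Behaviour near the singularity\<close>

lemma ln_add_powr_diff_at_bot:
  fixes c d \<kappa> a \<tau> :: real
  assumes "0 < \<tau>" "\<tau> < a" "\<kappa> > 0"
  shows "filterlim (\<lambda>\<delta>. c * ln \<delta> + d * \<delta> powr (-\<tau>) - \<kappa> * \<delta> powr (-a)) at_bot (at_right 0)"
  using assms by real_asymp

lemma ln_add_powr_le_powr:
  fixes c c' d \<sigma> \<alpha> :: real
  assumes "0 < \<alpha>" "\<alpha> < \<sigma>"
  shows "\<forall>\<^sub>F R in at_top. c' + c * ln R + d * R powr \<alpha> \<le> R powr \<sigma>"
  using assms by real_asymp

text \<open>An m-th root u of s T(0) / |T(0)| turns T(0) / u^m into the real number s |T(0)|. Along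
  the ray through u the real part of T(t) / t^m therefore tends to +infinity for s = 1 and to
  -infinity for s = -1.\<close>

lemma ray_normal_form:
  assumes \<phi>: "\<And>t. t \<in> ball 0 r - {0} \<Longrightarrow> \<phi> t = t powi k * E t * exp (T t / t ^ m)"
    and E: "E holomorphic_on ball 0 r" and T: "T holomorphic_on ball 0 r" "T 0 \<noteq> 0"
    and "m > 0" "r > 0" and s: "\<bar>s\<bar> = (1::real)"
  obtains u e \<tau> where "norm u = 1"
    "\<And>\<delta>. 0 < \<delta> \<Longrightarrow> \<delta> < r \<Longrightarrow> norm (\<phi> (of_real \<delta> * u)) = exp (of_int k * ln \<delta>) * e \<delta> * exp (\<tau> \<delta> / \<delta> ^ m)"
    "(e \<longlongrightarrow> norm (E 0)) (at_right 0)" "(\<tau> \<longlongrightarrow> s * norm (T 0)) (at_right 0)"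
proof -
  have "m \<noteq> 0" using \<open>m > 0\<close> by simp
  then obtain u where "of_real s * T 0 / norm (T 0) = u ^ m"
    by (rule exists_complex_root)
  note u = this[symmetric]
  have "norm u ^ m = 1 ^ m" using arg_cong[OF u, of norm] s T by (simp add: norm_power norm_mult norm_divide)
  then have norm_u: "norm u = 1" using \<open>m > 0\<close> power_eq_imp_eq_base[of "norm u" m 1] by simp
  have ray: "((\<lambda>\<delta>. of_real \<delta> * u) \<longlongrightarrow> 0) (at_right 0)"
    by (auto intro!: tendsto_eq_intros)
  have lim: "((\<lambda>\<delta>. f (of_real \<delta> * u)) \<longlongrightarrow> f 0) (at_right 0)" if "f holomorphic_on ball 0 r" for f :: "complex \<Rightarrow> complex"
  proof -
    have "isCont f 0"
      using holomorphic_on_imp_continuous_on[OF that] \<open>r > 0\<close> by (simp add: continuous_on_eq_continuous_at)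
    then show ?thesis using ray isCont_tendsto_compose by blast
  qed
  show ?thesis
  proof (rule that[of u "\<lambda>\<delta>. norm (E (of_real \<delta> * u))" "\<lambda>\<delta>. Re (T (of_real \<delta> * u) / u ^ m)"])
    show "((\<lambda>\<delta>. norm (E (of_real \<delta> * u))) \<longlongrightarrow> norm (E 0)) (at_right 0)"
      by (intro tendsto_norm lim E)
    have "T 0 / u ^ m = of_real (s * norm (T 0))"
      using s T unfolding u by (cases "s \<ge> 0") (auto simp: field_simps)
    moreover have "((\<lambda>\<delta>. Re (T (of_real \<delta> * u) / u ^ m)) \<longlongrightarrow> Re (T 0 / u ^ m)) (at_right 0)"
      using norm_u by (intro tendsto_Re tendsto_divide lim T tendsto_const) auto
    ultimately show "((\<lambda>\<delta>. Re (T (of_real \<delta> * u) / u ^ m)) \<longlongrightarrow> s * norm (T 0)) (at_right 0)"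
      by (simp only: Re_complex_of_real)
    fix \<delta> :: real assume \<delta>: "0 < \<delta>" "\<delta> < r"
    have "T (of_real \<delta> * u) / (of_real \<delta> * u) ^ m = (T (of_real \<delta> * u) / u ^ m) / of_real (\<delta> ^ m)"
      by (simp add: power_mult_distrib mult.commute)
    then have "Re (T (of_real \<delta> * u) / (of_real \<delta> * u) ^ m) = Re (T (of_real \<delta> * u) / u ^ m) / \<delta> ^ m"
      by (simp only: Re_divide_of_real)
    moreover have "\<delta> powi k = exp (of_int k * ln \<delta>)"
      using \<delta> by (simp add: powr_real_of_int'[symmetric] powr_def)
    moreover have "of_real \<delta> * u \<in> ball 0 r - {0}" using \<delta> norm_u by (auto simp: norm_mult)
    ultimately show "norm (\<phi> (of_real \<delta> * u)) =
        exp (of_int k * ln \<delta>) * norm (E (of_real \<delta> * u)) * exp (Re (T (of_real \<delta> * u) / u ^ m) / \<delta> ^ m)"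
      using \<delta> norm_u by (simp add: \<phi> norm_mult norm_power_int)
  qed (rule norm_u)
qed

text \<open>The ray with s = 1; halving the limits |E(0)| and |T(0)| gives strict lower bounds close
  to 0.\<close>

lemma normal_form_ray_lower_bound:
  assumes \<phi>: "\<And>t. t \<in> ball 0 r - {0} \<Longrightarrow> \<phi> t = t powi k * E t * exp (T t / t ^ m)"
    and E: "E holomorphic_on ball 0 r" "E 0 \<noteq> 0" and T: "T holomorphic_on ball 0 r" "T 0 \<noteq> 0"
    and "m > 0" "r > 0"
  obtains u A \<kappa> where "norm u = 1" "A > 0" "\<kappa> > 0"
    "\<forall>\<^sub>F \<delta> in at_right 0. A * exp (of_int k * ln \<delta> + \<kappa> * \<delta> powr (- real m)) \<le> norm (\<phi> (of_real \<delta> * u))"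
proof -
  obtain u e \<tau> where u: "norm u = 1"
    and eq: "\<And>\<delta>. 0 < \<delta> \<Longrightarrow> \<delta> < r \<Longrightarrow> norm (\<phi> (of_real \<delta> * u)) = exp (of_int k * ln \<delta>) * e \<delta> * exp (\<tau> \<delta> / \<delta> ^ m)"
    and lim: "(e \<longlongrightarrow> norm (E 0)) (at_right 0)" "(\<tau> \<longlongrightarrow> 1 * norm (T 0)) (at_right 0)"
    using ray_normal_form[OF \<phi> E(1) T \<open>m > 0\<close> \<open>r > 0\<close>, of 1] by auto
  define A \<kappa> where "A = norm (E 0) / 2" and "\<kappa> = norm (T 0) / 2"
  have pos: "A > 0" "\<kappa> > 0" using E T by (auto simp: A_def \<kappa>_def)
  have "\<forall>\<^sub>F \<delta> in at_right 0. A < e \<delta>" "\<forall>\<^sub>F \<delta> in at_right 0. \<kappa> < \<tau> \<delta>"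
    using order_tendstoD(1)[OF lim(1), of A] order_tendstoD(1)[OF lim(2), of \<kappa>] E T
    by (auto simp: A_def \<kappa>_def)
  moreover have "\<forall>\<^sub>F \<delta> in at_right 0. \<delta> \<in> {0<..<r}"
    using \<open>r > 0\<close> by (intro eventually_at_right_real)
  ultimately have "\<forall>\<^sub>F \<delta> in at_right 0. A * exp (of_int k * ln \<delta> + \<kappa> * \<delta> powr (- real m)) \<le> norm (\<phi> (of_real \<delta> * u))"
  proof eventually_elim
    case (elim \<delta>)
    have "A * exp (of_int k * ln \<delta> + \<kappa> * \<delta> powr (- real m)) = exp (of_int k * ln \<delta>) * A * exp (\<kappa> / \<delta> ^ m)"
      using elim by (simp add: exp_add powr_minus powr_realpow divide_inverse)
    also have "\<dots> \<le> exp (of_int k * ln \<delta>) * e \<delta> * exp (\<tau> \<delta> / \<delta> ^ m)"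
      using elim pos by (intro mult_mono) (auto intro!: divide_right_mono)
    finally show ?case using elim by (simp add: eq)
  qed
  with u pos that show ?thesis by blast
qed

text \<open>The ray with s = -1, on which the exponential factor decays.\<close>

lemma normal_form_ray_upper_bound:
  assumes \<phi>: "\<And>t. t \<in> ball 0 r - {0} \<Longrightarrow> \<phi> t = t powi k * E t * exp (T t / t ^ m)"
    and E: "E holomorphic_on ball 0 r" and T: "T holomorphic_on ball 0 r" "T 0 \<noteq> 0"
    and "m > 0" "r > 0"
  obtains u A \<kappa> where "norm u = 1" "A > 0" "\<kappa> > 0"
    "\<forall>\<^sub>F \<delta> in at_right 0. norm (\<phi> (of_real \<delta> * u)) \<le> A * exp (of_int k * ln \<delta> - \<kappa> * \<delta> powr (- real m))"
proof -
  obtain u e \<tau> where u: "norm u = 1"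
    and eq: "\<And>\<delta>. 0 < \<delta> \<Longrightarrow> \<delta> < r \<Longrightarrow> norm (\<phi> (of_real \<delta> * u)) = exp (of_int k * ln \<delta>) * e \<delta> * exp (\<tau> \<delta> / \<delta> ^ m)"
    and lim: "(e \<longlongrightarrow> norm (E 0)) (at_right 0)" "(\<tau> \<longlongrightarrow> (- 1) * norm (T 0)) (at_right 0)"
    using ray_normal_form[OF \<phi> E T \<open>m > 0\<close> \<open>r > 0\<close>, of "- 1"] by auto
  define A \<kappa> where "A = norm (E 0) + 1" and "\<kappa> = norm (T 0) / 2"
  have pos: "A > 0" "\<kappa> > 0" using T by (auto simp: A_def \<kappa>_def add_nonneg_pos)
  have "\<forall>\<^sub>F \<delta> in at_right 0. e \<delta> < A" "\<forall>\<^sub>F \<delta> in at_right 0. \<tau> \<delta> < - \<kappa>"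
    using order_tendstoD(2)[OF lim(1), of A] order_tendstoD(2)[OF lim(2), of "- \<kappa>"] T
    by (auto simp: A_def \<kappa>_def)
  moreover have "\<forall>\<^sub>F \<delta> in at_right 0. \<delta> \<in> {0<..<r}"
    using \<open>r > 0\<close> by (intro eventually_at_right_real)
  ultimately have "\<forall>\<^sub>F \<delta> in at_right 0. norm (\<phi> (of_real \<delta> * u)) \<le> A * exp (of_int k * ln \<delta> - \<kappa> * \<delta> powr (- real m))"
  proof eventually_elim
    case (elim \<delta>)
    have "norm (\<phi> (of_real \<delta> * u)) = exp (of_int k * ln \<delta>) * e \<delta> * exp (\<tau> \<delta> / \<delta> ^ m)"
      using elim by (simp add: eq)
    also have "\<dots> \<le> exp (of_int k * ln \<delta>) * A * exp ((- \<kappa>) / \<delta> ^ m)"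
    proof (rule mult_mono)
      show "exp (\<tau> \<delta> / \<delta> ^ m) \<le> exp ((- \<kappa>) / \<delta> ^ m)"
        unfolding exp_le_cancel_iff using elim by (intro divide_right_mono) auto
    qed (use elim pos in auto)
    also have "\<dots> = A * exp (of_int k * ln \<delta> - \<kappa> * \<delta> powr (- real m))"
      using elim by (simp add: exp_diff exp_minus powr_minus powr_realpow divide_inverse)
    finally show ?case .
  qed
  with u pos that show ?thesis by blast
qed

text \<open>A finite limit is refuted along the ray where \<phi> blows up, a pole along the ray
  where \<phi> tends to 0.\<close>

lemma essential_singularity_normal_form:
  assumes holo: "\<phi> holomorphic_on ball 0 r - {0}"
    and \<phi>: "\<And>t. t \<in> ball 0 r - {0} \<Longrightarrow> \<phi> t = t powi k * E t * exp (T t / t ^ m)"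
    and E: "E holomorphic_on ball 0 r" "E 0 \<noteq> 0" and T: "T holomorphic_on ball 0 r" "T 0 \<noteq> 0"
    and "m > 0" "r > 0"
  shows "essential_singularity_at \<phi> 0"
  unfolding essential_singularity_at_def
proof
  show "isolated_singularity_at \<phi> 0"
    using isolated_singularity_at_holomorphic[OF holo] \<open>r > 0\<close> by simp
  have ray: "filterlim (\<lambda>\<delta>. of_real \<delta> * u) (at 0) (at_right 0)" if "norm u = 1" for u :: complex
  proof -
    have "u \<noteq> 0" using that by auto
    then show ?thesis
      unfolding filterlim_at by (auto intro!: tendsto_eq_intros simp: eventually_at_filter)
  qed
  have small: "filterlim (\<lambda>\<delta>. A * exp (c * ln \<delta> - \<kappa> * \<delta> powr (- real m))) (nhds 0) (at_right 0)"
    if "\<kappa> > 0" for A c \<kappa> :: real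
  proof -
    have "filterlim (\<lambda>\<delta>. c * ln \<delta> - \<kappa> * \<delta> powr (- real m)) at_bot (at_right 0)"
      \<comment> \<open>The coefficient 0 removes the middle term; \<open>real m / 2\<close> is just
        some exponent between 0 and m.\<close>
      using ln_add_powr_diff_at_bot[of "real m / 2" "real m" \<kappa> c 0] that \<open>m > 0\<close> by simp
    then show ?thesis
      by (intro tendsto_mult_right_zero filterlim_compose[OF exp_at_bot])
  qed
  show "\<not> not_essential \<phi> 0"
  proof
    assume "not_essential \<phi> 0"
    then consider x where "\<phi> \<midarrow>0\<rightarrow> x" | "is_pole \<phi> 0" by (auto simp: not_essential_def)
    then show False
    proof cases
      case 1
      obtain u A \<kappa> where u: "norm u = 1" "A > 0" "\<kappa> > 0" and
        le: "\<forall>\<^sub>F \<delta> in at_right 0. A * exp (of_int k * ln \<delta> + \<kappa> * \<delta> powr (- real m)) \<le> norm (\<phi> (of_real \<delta> * u))"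
        by (rule normal_form_ray_lower_bound[OF \<phi> E T \<open>m > 0\<close> \<open>r > 0\<close>])
      \<comment> \<open>Multiplied by the reciprocal of the exponential in its lower bound, |\<phi>|
        would tend to 0 and yet stay at least \<open>A\<close>.\<close>
      have "((\<lambda>\<delta>. norm (\<phi> (of_real \<delta> * u)) * (1 * exp ((- of_int k) * ln \<delta> - \<kappa> * \<delta> powr (- real m)))) \<longlongrightarrow> norm x * 0) (at_right 0)"
        by (intro tendsto_mult tendsto_norm small u filterlim_compose[OF 1] ray)
      moreover have "\<forall>\<^sub>F \<delta> in at_right 0. A \<le> norm (\<phi> (of_real \<delta> * u)) * (1 * exp ((- of_int k) * ln \<delta> - \<kappa> * \<delta> powr (- real m)))"
        using le
      proof eventually_elim
        case (elim \<delta>)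
        let ?x = "of_int k * ln \<delta> + \<kappa> * \<delta> powr (- real m)"
        have "A = A * exp ?x * exp (- ?x)"
          by (simp only: mult.assoc exp_minus_inverse mult_1_right)
        also have "\<dots> \<le> norm (\<phi> (of_real \<delta> * u)) * exp (- ?x)" by (intro mult_right_mono elim) auto
        finally show ?case by simp
      qed
      ultimately have "A \<le> norm x * 0" by (intro tendsto_lowerbound) auto
      then show False using u by simp
    next
      case 2
      obtain u A \<kappa> where u: "norm u = 1" "A > 0" "\<kappa> > 0" and
        le: "\<forall>\<^sub>F \<delta> in at_right 0. norm (\<phi> (of_real \<delta> * u)) \<le> A * exp (of_int k * ln \<delta> - \<kappa> * \<delta> powr (- real m))"
        by (rule normal_form_ray_upper_bound[OF \<phi> E(1) T \<open>m > 0\<close> \<open>r > 0\<close>])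
      have "((\<lambda>\<delta>. \<phi> (of_real \<delta> * u)) \<longlongrightarrow> 0) (at_right 0)"
        using le by (rule Lim_null_comparison) (rule small[OF u(3)])
      moreover have "filterlim (\<lambda>\<delta>. \<phi> (of_real \<delta> * u)) at_infinity (at_right 0)"
        using 2 ray[OF u(1)] unfolding is_pole_def by (rule filterlim_compose)
      ultimately show False
        using not_tendsto_and_filterlim_at_infinity[of "at_right (0 :: real)"] by (auto simp: trivial_limit_at_right_real)
    qed
  qed
qed

text \<open>In the case p = 1 the exponential factor is absorbed into \<open>E\<close>, and \<phi>
  is meromorphic at 0.\<close>

lemma not_essential_singularity_powi_mult:
  assumes \<phi>: "\<And>t. t \<in> ball 0 r - {0} \<Longrightarrow> \<phi> t = t powi k * E t"
    and E: "E holomorphic_on ball 0 r" and "r > 0"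
  shows "\<not> essential_singularity_at \<phi> 0"
proof -
  have "E analytic_on {0}" unfolding analytic_at_ball using E \<open>r > 0\<close> by auto
  then have "(\<lambda>t. t powi k * E t) meromorphic_on {0}"
    by (intro meromorphic_intros analytic_on_imp_meromorphic_on)
  then have "not_essential (\<lambda>t. t powi k * E t) 0"
    by (rule meromorphic_on_not_essential)
  moreover have "\<forall>\<^sub>F t in at 0. t powi k * E t = \<phi> t"
    using eventually_at_in_open[of "ball 0 r" "0 :: complex"] \<open>r > 0\<close>
    by (auto elim!: eventually_mono simp: \<phi>)
  ultimately have "not_essential \<phi> 0"
    by (rule not_essential_transform)
  then show ?thesis
    by (simp add: essential_singularity_at_def)
qed

section \<open>Lower and upper bounds for the growth of w when p > 1\<close>

lemma growth_residue_solution_lower: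
  assumes holo: "\<phi> holomorphic_on ball 0 r - {0}"
    and \<phi>: "\<And>t. t \<in> ball 0 r - {0} \<Longrightarrow> \<phi> t = t powi k * E t * exp (T t / t ^ m)"
    and E: "E holomorphic_on ball 0 r" "E 0 \<noteq> 0" and T: "T holomorphic_on ball 0 r" "T 0 \<noteq> 0"
    and "m > 0" "r > 0" and \<sigma>: "0 < \<sigma>" "\<sigma> < 1 - 1 / real (Suc m)"
  shows "\<not> (\<forall>\<^sub>F R in at_top. max_modulus R (residue_solution \<phi>) \<le> exp (R powr \<sigma>))"
proof
  assume growth: "\<forall>\<^sub>F R in at_top. max_modulus R (residue_solution \<phi>) \<le> exp (R powr \<sigma>)"
  have "1 / real (Suc m) > 0" by simp
  then have "\<sigma> < 1" using \<sigma> by linarith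
  \<comment> \<open>\<sigma> < m / (m + 1) is equivalent to \<tau> < m, so the bound on \<phi>
    derived from the growth of w falls short of its growth on the ray.\<close>
  define \<tau> where "\<tau> = \<sigma> / (1 - \<sigma>)"
  have \<tau>: "0 < \<tau>" "\<tau> < real m" using \<sigma> \<open>\<sigma> < 1\<close> by (auto simp: \<tau>_def field_simps)
  obtain B C \<kappa>' where up: "\<And>s. s \<noteq> 0 \<Longrightarrow> norm s < r / 4 \<Longrightarrow>
     norm (\<phi> s) \<le> B + C / norm s * exp (\<kappa>' * norm s powr (- \<tau>))"
    using norm_le_if_growth_residue_solution[OF holo \<open>r > 0\<close> \<sigma>(1) \<open>\<sigma> < 1\<close> growth]
    unfolding \<tau>_def by blast
  obtain u A \<kappa> where u: "norm u = 1" "A > 0" "\<kappa> > 0" and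
    low: "\<forall>\<^sub>F \<delta> in at_right 0. A * exp (of_int k * ln \<delta> + \<kappa> * \<delta> powr (- real m)) \<le> norm (\<phi> (of_real \<delta> * u))"
    by (rule normal_form_ray_lower_bound[OF \<phi> E T \<open>m > 0\<close> \<open>r > 0\<close>])
  \<comment> \<open>Quotients of the terms of the upper bound by the exponential of the lower bound:
    the constant term gives c = -k and d = 0, and the factor 1 / \<delta> of the other term lowers c
    by 1.\<close>
  define f where "f = (\<lambda>c d \<delta>. exp (c * ln \<delta> + d * \<delta> powr (- \<tau>) - \<kappa> * \<delta> powr (- real m)))"
  have f: "(f c d \<longlongrightarrow> 0) (at_right 0)" for c d
    unfolding f_def using \<tau> u by (intro filterlim_compose[OF exp_at_bot] ln_add_powr_diff_at_bot)
  have "\<forall>\<^sub>F \<delta> in at_right 0. \<delta> \<in> {0<..<r / 4}"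
    using \<open>r > 0\<close> by (intro eventually_at_right_real) auto
  then have "\<forall>\<^sub>F \<delta> in at_right 0. A \<le> B * f (- of_int k) 0 \<delta> + C * f (- of_int k - 1) \<kappa>' \<delta>"
    using low
  proof eventually_elim
    case (elim \<delta>)
    let ?x = "of_int k * ln \<delta> + \<kappa> * \<delta> powr (- real m)"
    have "\<delta> > 0" using elim(1) by simp
    have "A * exp ?x \<le> B + C / \<delta> * exp (\<kappa>' * \<delta> powr (- \<tau>))"
      using elim up[of "of_real \<delta> * u"] u(1) norm_eq_zero[of u] by (simp add: norm_mult)
    then have "A * exp ?x * exp (- ?x) \<le> (B + C / \<delta> * exp (\<kappa>' * \<delta> powr (- \<tau>))) * exp (- ?x)"
      by (intro mult_right_mono) auto
    also have "A * exp ?x * exp (- ?x) = A"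
      by (simp only: mult.assoc exp_minus_inverse mult_1_right)
    also have "(B + C / \<delta> * exp (\<kappa>' * \<delta> powr (- \<tau>))) * exp (- ?x) =
        B * f (- of_int k) 0 \<delta> + C * (exp (- ln \<delta>) * exp (\<kappa>' * \<delta> powr (- \<tau>)) * exp (- ?x))"
    proof -
      have "(B + C / \<delta> * y) * x = B * x + C * (1 / \<delta> * y * x)" for x y
        by (simp add: distrib_right)
      moreover have "f (- of_int k) 0 \<delta> = exp (- ?x)" by (simp add: f_def)
      moreover have "exp (- ln \<delta>) = 1 / \<delta>" using \<open>\<delta> > 0\<close> by (simp add: exp_minus divide_inverse)
      ultimately show ?thesis by (simp only:)
    qed
    also have "exp (- ln \<delta>) * exp (\<kappa>' * \<delta> powr (- \<tau>)) * exp (- ?x) = f (- of_int k - 1) \<kappa>' \<delta>"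
      unfolding f_def exp_add[symmetric] by (simp add: algebra_simps)
    finally show ?case .
  qed
  moreover have "((\<lambda>\<delta>. B * f (- of_int k) 0 \<delta> + C * f (- of_int k - 1) \<kappa>' \<delta>) \<longlongrightarrow> B * 0 + C * 0) (at_right 0)"
    by (intro tendsto_intros f)
  ultimately have "A \<le> B * 0 + C * 0" by (intro tendsto_lowerbound) auto
  then show False using u by simp
qed

lemma growth_residue_solution_upper:
  assumes holo: "\<phi> holomorphic_on ball 0 r - {0}"
    and \<phi>: "\<And>t. t \<in> ball 0 r - {0} \<Longrightarrow> \<phi> t = t powi k * E t * exp (T t / t ^ m)"
    and E: "E holomorphic_on ball 0 r" and T: "T holomorphic_on ball 0 r"
    and "m > 0" "r > 0" and \<sigma>: "1 - 1 / real (Suc m) < \<sigma>"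
  shows "\<forall>\<^sub>F R in at_top. max_modulus R (residue_solution \<phi>) \<le> exp (R powr \<sigma>)"
proof -
  define \<alpha> where "\<alpha> = 1 - 1 / real (Suc m)"
  have \<alpha>: "0 < \<alpha>" "\<alpha> < \<sigma>" "\<alpha> = real m / real (Suc m)"
    using \<sigma> \<open>m > 0\<close> by (auto simp: \<alpha>_def field_simps)
  have bdd: "\<exists>B>0. \<forall>t\<in>cball 0 (r / 2). norm (f t) \<le> B" if "f holomorphic_on ball 0 r" for f :: "complex \<Rightarrow> complex"
  proof -
    have "continuous_on (cball 0 (r / 2)) f"
      by (rule continuous_on_subset[OF holomorphic_on_imp_continuous_on[OF that]]) (use \<open>r > 0\<close> in auto)
    then have "bounded (f ` cball 0 (r / 2))"
      by (intro compact_imp_bounded compact_continuous_image) auto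
    then show ?thesis by (auto simp: bounded_pos)
  qed
  obtain Em where Em: "Em > 0" "\<And>t. norm t \<le> r / 2 \<Longrightarrow> norm (E t) \<le> Em" using bdd[OF E] by auto
  obtain Tm where Tm: "Tm > 0" "\<And>t. norm t \<le> r / 2 \<Longrightarrow> norm (T t) \<le> Tm" using bdd[OF T] by auto
  \<comment> \<open>At this radius R \<rho> and \<rho>^-m both equal R^(m / (m + 1)), so the kernel
    exp(-zt) and the singular factor have bounds of the same order.\<close>
  define \<rho> where "\<rho> = (\<lambda>R. R powr (- (1 / real (Suc m))))"
  have "(\<rho> \<longlongrightarrow> 0) at_top"
    unfolding \<rho>_def by (intro tendsto_neg_powr filterlim_ident) auto
  then have "\<forall>\<^sub>F R in at_top. \<rho> R < r / 2"
    using \<open>r > 0\<close> by (intro order_tendstoD) auto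
  \<comment> \<open>The left side is the logarithm of the final bound \<open>B * d\<close>. The 1 in
    \<open>Tm + 1\<close> comes from exp(-zt), the 1 in \<open>of_int k + 1\<close> from the length
    of the circle.\<close>
  moreover have "\<forall>\<^sub>F R in at_top. ln Em + (- (of_int k + 1) / real (Suc m)) * ln R + (Tm + 1) * R powr \<alpha> \<le> R powr \<sigma>"
    using \<alpha> by (intro ln_add_powr_le_powr) auto
  ultimately show ?thesis
    using eventually_gt_at_top[of 0]
  proof eventually_elim
    case (elim R)
    define d where "d = \<rho> R"
    have d: "0 < d" "d < r / 2" using elim by (auto simp: d_def \<rho>_def)
    have ln_d: "ln d = - (1 / real (Suc m)) * ln R" using elim by (simp add: d_def \<rho>_def ln_powr)
    have Rd: "R * d = R powr \<alpha>"
    proof -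
      have "R * d = R powr 1 * R powr (- (1 / real (Suc m)))" using elim by (simp add: d_def \<rho>_def)
      then show ?thesis unfolding powr_add[symmetric] by (simp add: \<alpha>_def)
    qed
    have dm: "1 / d ^ m = R powr \<alpha>"
    proof -
      have "d ^ m = R powr (- \<alpha>)"
        using d elim by (simp add: powr_realpow[symmetric] d_def \<rho>_def powr_powr \<alpha>(3))
      then show ?thesis by (simp add: powr_minus divide_inverse)
    qed
    define B where "B = exp (of_int k * ln d) * Em * exp (Tm * R powr \<alpha>) * exp (R powr \<alpha>)"
    have "B > 0" using Em by (simp add: B_def)
    show ?case
    proof (rule max_modulus_leI)
      fix z :: complex assume z: "norm z = R"
      have "norm (2 * pi * \<i> * residue_solution \<phi> z) \<le> B * (2 * pi * d)"
      proof (rule has_contour_integral_bound_circlepath)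
        show "((\<lambda>t. \<phi> t * exp (- z * t)) has_contour_integral 2 * pi * \<i> * residue_solution \<phi> z) (circlepath 0 d)"
          using d \<open>r > 0\<close> by (intro has_contour_integral_residue_solution[OF holo]) auto
        fix t :: complex assume "norm (t - 0) = d"
        then have t: "norm t = d" by simp
        have "t \<in> ball 0 r - {0}" using t d by auto
        then have "norm (\<phi> t * exp (- z * t)) = d powi k * norm (E t) * exp (Re (T t / t ^ m)) * exp (Re (- z * t))"
          using t by (simp add: \<phi> norm_mult norm_power_int)
        also have "\<dots> \<le> exp (of_int k * ln d) * Em * exp (Tm * R powr \<alpha>) * exp (R powr \<alpha>)"
        proof (intro mult_mono)
          show "d powi k \<le> exp (of_int k * ln d)"
            using d by (simp add: powr_real_of_int'[symmetric] powr_def)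
          show "norm (E t) \<le> Em" using Em t d by simp
          have "Re (T t / t ^ m) \<le> norm (T t) / norm (t ^ m)"
            using complex_Re_le_cmod by (metis norm_divide)
          also have "\<dots> \<le> Tm / d ^ m"
            using Tm t d by (auto simp: norm_power intro!: divide_right_mono)
          also have "\<dots> = Tm * R powr \<alpha>" by (simp add: dm[symmetric])
          finally show "exp (Re (T t / t ^ m)) \<le> exp (Tm * R powr \<alpha>)" by simp
          have "Re (- z * t) \<le> norm (- z * t)" by (rule complex_Re_le_cmod)
          also have "\<dots> = R powr \<alpha>" using z t Rd by (simp add: norm_mult)
          finally show "exp (Re (- z * t)) \<le> exp (R powr \<alpha>)" by simp
        qed (use Em d in auto)
        finally show "norm (\<phi> t * exp (- z * t)) \<le> B" by (simp add: B_def)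
      qed (use \<open>B > 0\<close> d in auto)
      then have "norm (residue_solution \<phi> z) \<le> B * d" unfolding norm_mult by simp
      also have "B * d = exp (of_int k * ln d) * exp (ln Em) * exp (Tm * R powr \<alpha>) * exp (R powr \<alpha>) * exp (ln d)"
        using Em d by (simp add: B_def)
      also have "\<dots> = exp (ln Em + (- (of_int k + 1) / real (Suc m)) * ln R + (Tm + 1) * R powr \<alpha>)"
        unfolding exp_add[symmetric] ln_d by (simp add: algebra_simps add_divide_distrib diff_divide_distrib)
      also have "\<dots> \<le> exp (R powr \<sigma>)" using elim by simp
      finally show "norm (residue_solution \<phi> z) \<le> exp (R powr \<sigma>)" .
    qed (use elim in auto)
  qed
qed

section \<open>The case p = 1: Taylor coefficients of w at 0\<close>

text \<open>The Taylor series at 0 breaks off. For \<open>N = 0\<close> the sum is empty and the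
  function vanishes, which settles the case of a negative residue.\<close>

lemma entire_eq_poly:
  assumes f: "f holomorphic_on UNIV" and 0: "\<And>k. k \<ge> N \<Longrightarrow> (deriv ^^ k) f 0 = 0"
  shows "f z = poly (\<Sum>k<N. monom ((deriv ^^ k) f 0 / fact k) k) z"
proof -
  have "(\<lambda>k. (deriv ^^ k) f 0 / fact k * (z - 0) ^ k) sums f z"
    using f by (intro holomorphic_power_series[of f 0 "norm z + 1"]) (auto intro: holomorphic_on_subset)
  moreover have "(\<lambda>k. (deriv ^^ k) f 0 / fact k * (z - 0) ^ k) sums (\<Sum>k<N. (deriv ^^ k) f 0 / fact k * (z - 0) ^ k)"
    by (intro sums_finite) (auto simp: 0)
  ultimately show ?thesis
    by (auto dest: sums_unique2 simp: poly_sum poly_monom)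
qed

text \<open>The derivative is the residue of (-1)^j E(t) t^(j-l-1). For j > l this function is
  holomorphic at 0; for j = l it is (-1)^j E(t) / t.\<close>

lemma higher_deriv_residue_solution_0:
  assumes holo: "\<phi> holomorphic_on ball 0 r - {0}"
    and \<phi>: "\<And>t. t \<in> ball 0 r - {0} \<Longrightarrow> \<phi> t = t powi (- (1 + l)) * E t"
    and E: "E holomorphic_on ball 0 r" and "r > 0"
  shows "int j > l \<Longrightarrow> (deriv ^^ j) (residue_solution \<phi>) 0 = 0"
    and "int j = l \<Longrightarrow> (deriv ^^ j) (residue_solution \<phi>) 0 = (- 1) ^ j * E 0"
proof -
  have ev: "\<forall>\<^sub>F t in at 0. t \<in> ball 0 r - {0 :: complex}"
    using \<open>r > 0\<close> by (intro eventually_at_in_open) auto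
  have eq: "(- t) ^ j * \<phi> t * exp (- 0 * t) = (- 1) ^ j * E t * t powi (int j - l - 1)"
    if "t \<in> ball 0 r - {0}" for t
  proof -
    have "int j - l - 1 = int j + - (1 + l)" by simp
    then have "t ^ j * t powi (- (1 + l)) = t powi (int j - l - 1)"
      using that by (simp only:) (subst power_int_add, auto)
    moreover have "(- t) ^ j = (- 1) ^ j * t ^ j" by (simp flip: power_mult_distrib)
    ultimately show ?thesis using that by (simp add: \<phi> mult_ac)
  qed
  have deriv: "(deriv ^^ j) (residue_solution \<phi>) 0 = residue (\<lambda>t. (- t) ^ j * \<phi> t * exp (- 0 * t)) 0"
    unfolding higher_deriv_residue_solution[OF holo \<open>r > 0\<close>] residue_solution_def ..
  show "(deriv ^^ j) (residue_solution \<phi>) 0 = 0" if "int j > l"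
  proof -
    have "(deriv ^^ j) (residue_solution \<phi>) 0 = residue (\<lambda>t. (- 1) ^ j * E t * t ^ nat (int j - l - 1)) 0"
      unfolding deriv
    proof (intro residue_cong refl eventually_mono[OF ev])
      fix t assume "t \<in> ball 0 r - {0 :: complex}"
      with eq that show "(- t) ^ j * \<phi> t * exp (- 0 * t) = (- 1) ^ j * E t * t ^ nat (int j - l - 1)"
        by (simp add: power_int_def)
    qed
    also have "\<dots> = 0"
      using \<open>r > 0\<close> by (intro residue_holo[of "ball 0 r"] holomorphic_intros E) auto
    finally show ?thesis .
  qed
  show "(deriv ^^ j) (residue_solution \<phi>) 0 = (- 1) ^ j * E 0" if "int j = l"
  proof -
    have "(deriv ^^ j) (residue_solution \<phi>) 0 = residue (\<lambda>t. (- 1) ^ j * E t / (t - 0)) 0"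
      unfolding deriv
    proof (intro residue_cong refl eventually_mono[OF ev])
      fix t assume "t \<in> ball 0 r - {0 :: complex}"
      with eq that show "(- t) ^ j * \<phi> t * exp (- 0 * t) = (- 1) ^ j * E t / (t - 0)"
        by (simp add: power_int_minus divide_inverse)
    qed
    also have "\<dots> = (- 1) ^ j * E 0"
      using \<open>r > 0\<close> by (intro residue_simple[of "ball 0 r"] holomorphic_intros E) auto
    finally show ?thesis .
  qed
qed

lemma degree_sum_monom_lessThan_Suc:
  assumes "c N \<noteq> (0 :: 'a :: comm_semiring_1)"
  shows "degree (\<Sum>k<Suc N. monom (c k) k) = N"
proof (rule antisym)
  show "degree (\<Sum>k<Suc N. monom (c k) k) \<le> N"
    by (intro degree_sum_le) (auto intro: order_trans[OF degree_monom_le])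
  have "coeff (\<Sum>k<Suc N. monom (c k) k) N = c N"
    by (simp add: coeff_sum)
  then show "N \<le> degree (\<Sum>k<Suc N. monom (c k) k)"
    using assms by (intro le_degree) simp
qed

section \<open>Existence of a branch and the properties of every branch\<close>

theorem theorem5:
  fixes n q p :: nat and a b :: "nat \<Rightarrow> complex" and lam0 :: int
  assumes "n \<ge> 1" and "q \<le> n - 1"
    and "\<not> (\<forall>z. a 0 + b 0 * z = 0)"
    and "\<And>j. q < j \<Longrightarrow> j < n \<Longrightarrow> b j = 0"
    and "b q = (- 1) ^ (n - q + 1)"
    and "p \<ge> 1"
    and "is_pole (\<lambda>t. Q0 n a t / Q1 q b t) 0"
    and "zorder (\<lambda>t. Q0 n a t / Q1 q b t) 0 = - int p"
    and "residue (\<lambda>t. Q0 n a t / Q1 q b t) 0 = of_int lam0"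
  shows "(\<exists>r>0. \<exists>\<phi>. phi_L_branch n q a b (ball 0 r - {0}) \<phi>) \<and>
    (\<forall>r>0. \<forall>\<phi>. phi_L_branch n q a b (ball 0 r - {0}) \<phi> \<longrightarrow>
       residue_solution \<phi> holomorphic_on UNIV \<and>
       (\<forall>z. L_op n a b (residue_solution \<phi>) z = 0) \<and>
       (essential_singularity_at \<phi> 0 \<longleftrightarrow> p > 1) \<and>
       (p > 1 \<longrightarrow> growth_order (residue_solution \<phi>) = ereal (1 - 1 / real p)) \<and>
       (p = 1 \<longrightarrow>
          (lam0 \<ge> 0 \<longrightarrow>
             (\<exists>P. P \<noteq> 0 \<and> int (degree P) = lam0 \<and> (\<forall>z. residue_solution \<phi> z = poly P z))) \<and>
          (lam0 < 0 \<longrightarrow> (\<forall>z. residue_solution \<phi> z = 0))))"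
proof -
  note n = assms(1) and q = assms(2) and b = assms(4) and pole = assms(7)
  obtain m where p: "p = Suc m" using \<open>p \<ge> 1\<close> by (cases p) auto
  obtain Q where Q: "\<And>t. Q1 q b t = t ^ p * poly Q t" "poly Q 0 \<noteq> 0" and Q0: "Q0 n a 0 \<noteq> 0"
    using Q1_eq_power_times_poly[OF n assms(3) pole assms(8)] by blast
  \<comment> \<open>Stated for any radius because it serves twice: on a small disc for constructing
    a branch, and on the disc of a given branch.\<close>
  have antiderivative: "\<exists>T H. T holomorphic_on ball 0 r \<and> H holomorphic_on ball 0 r \<and> (m > 0 \<longrightarrow> T 0 \<noteq> 0) \<and>
      (\<forall>t\<in>ball 0 r - {0}. ((\<lambda>t. T t / t ^ m + H t) has_field_derivative
         of_int lam0 / t - Q0 n a t / Q1 q b t) (at t))"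
    if "r > 0" and nz: "\<And>t. t \<in> ball 0 r \<Longrightarrow> poly Q t \<noteq> 0" for r
  proof -
    let ?g = "\<lambda>t. Q0 n a t / poly Q t"
    have eq: "?g t / t ^ Suc m = Q0 n a t / Q1 q b t" for t by (simp add: Q p)
    have holo: "?g holomorphic_on ball 0 r"
      unfolding Q0_def using nz by (intro holomorphic_intros) auto
    have g0: "?g 0 \<noteq> 0" using Q0 Q(2) by simp
    have res: "residue (\<lambda>t. ?g t / t ^ Suc m) 0 = of_int lam0"
      unfolding eq by (rule assms(9))
    obtain T H where "T holomorphic_on ball 0 r" "H holomorphic_on ball 0 r" "m > 0 \<Longrightarrow> T 0 \<noteq> 0"
      and deriv: "\<And>t. t \<in> ball 0 r - {0} \<Longrightarrow>
       ((\<lambda>t. T t / t ^ m + H t) has_field_derivative of_int lam0 / t - ?g t / t ^ Suc m) (at t)"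
      by (rule antiderivative_normal_form[OF holo g0 \<open>r > 0\<close> res]) (rule that)
    moreover note deriv[unfolded eq]
    ultimately show ?thesis by blast
  qed
  have "open {t. poly Q t \<noteq> 0}"
    by (intro open_Collect_neq continuous_intros)
  then obtain r0 where "r0 > 0" "ball 0 r0 \<subseteq> {t. poly Q t \<noteq> 0}"
    using Q(2) by (auto elim: openE)
  then have r0: "r0 > 0" "\<And>t. t \<in> ball 0 r0 \<Longrightarrow> poly Q t \<noteq> 0" by blast+
  show ?thesis
  proof (intro conjI allI impI)
    from antiderivative[OF r0] obtain T H where TH: "T holomorphic_on ball 0 r0" "H holomorphic_on ball 0 r0"
      "\<And>t. t \<in> ball 0 r0 - {0} \<Longrightarrow> ((\<lambda>t. T t / t ^ m + H t) has_field_derivative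
         of_int lam0 / t - Q0 n a t / Q1 q b t) (at t)" by blast
    have "poly Q holomorphic_on ball 0 r0" by (intro holomorphic_intros)
    from phi_L_branch_ex[OF Q(1) this r0(2) TH]
    show "\<exists>r>0. \<exists>\<phi>. phi_L_branch n q a b (ball 0 r - {0}) \<phi>" using r0(1) by blast
  next
    fix r :: real and \<phi>
    assume r: "r > 0" and branch: "phi_L_branch n q a b (ball 0 r - {0}) \<phi>"
    then have holo: "\<phi> holomorphic_on ball 0 r - {0}" by (simp add: phi_L_branch_def)
    show "residue_solution \<phi> holomorphic_on UNIV"
      by (rule holomorphic_residue_solution[OF holo r])
    show "L_op n a b (residue_solution \<phi>) z = 0" for z
      using q n by (intro L_op_residue_solution_eq_0[OF r _ b holo phi_L_branch_D(3)[OF branch]]) auto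
    \<comment> \<open>A branch presupposes that Q1 has no zeros on the punctured ball, so the
      cofactor has none on the ball and the normal form holds on all of it.\<close>
    have nz: "poly Q t \<noteq> 0" if "t \<in> ball 0 r" for t
      using phi_L_branch_D(1)[OF branch, of t] that Q by (cases "t = 0") auto
    from antiderivative[OF r nz] obtain T H where T: "T holomorphic_on ball 0 r" "m > 0 \<Longrightarrow> T 0 \<noteq> 0"
      and H: "H holomorphic_on ball 0 r"
      and TH: "\<And>t. t \<in> ball 0 r - {0} \<Longrightarrow> ((\<lambda>t. T t / t ^ m + H t) has_field_derivative
         of_int lam0 / t - Q0 n a t / Q1 q b t) (at t)" by blast
    obtain c where "c \<noteq> 0" and \<phi>: "\<And>t. t \<in> ball 0 r - {0} \<Longrightarrow>
       \<phi> t = t powi (- (int p + lam0)) * (c * exp (H t) / poly Q t) * exp (T t / t ^ m)"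
      using phi_L_branch_normal_form[OF branch r Q(1) TH] by blast
    define E where "E = (\<lambda>t. c * exp (H t) / poly Q t)"
    have E: "E holomorphic_on ball 0 r" "E 0 \<noteq> 0"
      unfolding E_def using nz Q(2) \<open>c \<noteq> 0\<close> by (auto intro!: holomorphic_intros H)
    have \<phi>: "\<phi> t = t powi (- (int p + lam0)) * E t * exp (T t / t ^ m)" if "t \<in> ball 0 r - {0}" for t
      unfolding E_def by (rule \<phi>[OF that])
    \<comment> \<open>For p = 1 the exponent is T(t) / t^0, so its exponential is holomorphic and
      joins the cofactor.\<close>
    define E' where "E' = (\<lambda>t. E t * exp (T t))"
    have E': "E' holomorphic_on ball 0 r" "E' 0 \<noteq> 0"
      unfolding E'_def using E by (auto intro!: holomorphic_intros T)
    have \<phi>': "\<phi> t = t powi (- (1 + lam0)) * E' t" if "p = 1" "t \<in> ball 0 r - {0}" for t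
      using \<phi>[OF that(2)] that p by (simp add: E'_def)
    show "essential_singularity_at \<phi> 0 \<longleftrightarrow> p > 1"
    proof
      assume "p > 1"
      then have "m > 0" using p by simp
      then show "essential_singularity_at \<phi> 0"
        by (intro essential_singularity_normal_form[OF holo \<phi> E T(1)] T r)
    next
      assume ess: "essential_singularity_at \<phi> 0"
      show "p > 1"
      proof (rule ccontr)
        assume "\<not> p > 1"
        then have "p = 1" using p by simp
        from not_essential_singularity_powi_mult[OF \<phi>'[OF this] E'(1) r] ess show False by blast
      qed
    qed
    show "growth_order (residue_solution \<phi>) = ereal (1 - 1 / real p)" if "p > 1"
    proof (rule growth_order_eqI)
      have m: "m > 0" using that p by simp
      show "residue_solution \<phi> holomorphic_on UNIV" by (rule holomorphic_residue_solution[OF holo r])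
      show "1 - 1 / real p > 0" using that by simp
      show "\<forall>\<^sub>F R in at_top. max_modulus R (residue_solution \<phi>) \<le> exp (R powr \<sigma>)"
        if "1 - 1 / real p < \<sigma>" for \<sigma>
        using growth_residue_solution_upper[OF holo \<phi> E(1) T(1) m r] that p by simp
      show "\<not> (\<forall>\<^sub>F R in at_top. max_modulus R (residue_solution \<phi>) \<le> exp (R powr \<sigma>))"
        if "0 < \<sigma>" "\<sigma> < 1 - 1 / real p" for \<sigma>
        using growth_residue_solution_lower[OF holo \<phi> E T(1) T(2)[OF m] m r] that p by simp
    qed
    assume "p = 1"
    note derivs = higher_deriv_residue_solution_0[OF holo \<phi>'[OF this] E'(1) r]
    note poly = entire_eq_poly[OF holomorphic_residue_solution[OF holo r]]
    show "\<exists>P. P \<noteq> 0 \<and> int (degree P) = lam0 \<and> (\<forall>z. residue_solution \<phi> z = poly P z)" if "lam0 \<ge> 0"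
    proof -
      define N where "N = nat lam0"
      define c where "c = (\<lambda>k. (deriv ^^ k) (residue_solution \<phi>) 0 / fact k)"
      \<comment> \<open>The coefficients vanish above \<open>lam0\<close>, so the sum includes
        \<open>N\<close>; the leading coefficient is (-1)^N E'(0) / N!.\<close>
      define P where "P = (\<Sum>k<Suc N. monom (c k) k)"
      have lam0: "lam0 = int N" using that by (simp add: N_def)
      have "c N \<noteq> 0" using derivs(2)[of N] E'(2) by (simp add: c_def lam0)
      moreover have "coeff P N = c N" by (simp add: P_def coeff_sum)
      ultimately have "P \<noteq> 0" by auto
      moreover have "degree P = N"
        unfolding P_def by (rule degree_sum_monom_lessThan_Suc) fact
      moreover have "residue_solution \<phi> z = poly P z" for z
        unfolding P_def c_def by (rule poly) (auto intro!: derivs simp: lam0)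
      ultimately show ?thesis using lam0 by blast
    qed
    \<comment> \<open>Every order of derivative exceeds a negative \<open>lam0\<close>, so all
      Taylor coefficients vanish.\<close>
    show "residue_solution \<phi> z = 0" if "lam0 < 0" for z
      using poly[of 0 z] derivs(1) that by simp
  qed
qed

end
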